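(* If $T$ is an unbiased shift embedding a probability measure $\nu\neq\delta_0$ on $\mathbb{R}$, then $$\mathbb{E}_0\sqrt{|T|}=\infty.$$
   Context: Let $\Omega$ be the set of continuous functions $\omega:\mathbb{R}\to\mathbb{R}$ with the Kolmogorov product $\sigma$-algebra, let $B=(B_t)_{t\in\mathbb{R}}$ be the identity (coordinate process) on $\Omega$, and let $\mathbb{P}_0$ be the law of a two-sided standard Brownian motion with $B_0=0$, with expectation $\mathbb{E}_0$. A random time is a measurable function $T$ of $B$ with values in $\mathbb{R}$ (of arbitrary sign, not assumed to be a stopping time). $T$ is an unbiased shift if, under $\mathbb{P}_0$, $(B_{T+t}-B_T)_{t\in\mathbb{R}}$ is a two-sided standard Brownian motion independent of $B_T$. $T$ embeds $\nu$ if $B_T$ has distribution $\nu$ under $\mathbb{P}_0$. $\delta_0$ is the unit mass at $0$. *)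

theory Defs
  imports "HOL-Probability.Probability"
begin

text \<open>The space \<open>\<Omega>\<close> of continuous paths, with the trace of the Kolmogorov product
  \<open>\<sigma>\<close>-algebra (the one generated by the coordinates).\<close>

definition path_space :: "(real \<Rightarrow> real) measure" where
  "path_space =
     restrict_space (Pi\<^sub>M UNIV (\<lambda>_::real. borel)) {\<omega>. continuous_on UNIV \<omega>}"

text \<open>A two-sided standard Brownian motion started at 0, as a process indexed by the whole
  real line. Since the increments are taken between arbitrary real times, this says that
  \<open>(X\<^sub>t)\<close> and \<open>(X\<^sub>-\<^sub>t)\<close>, \<open>t \<ge> 0\<close>, are independent one-sided standard Brownian motions.
  The condition \<open>X\<^sub>0 = 0\<close> must be an almost sure one: the coordinate process on
  \<^const>\<open>path_space\<close> satisfies it only outside a null set. The second parameter of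
  \<^const>\<open>normal_density\<close> is the standard deviation.\<close>

definition two_sided_BM :: "'a measure \<Rightarrow> (real \<Rightarrow> 'a \<Rightarrow> real) \<Rightarrow> bool" where
  "two_sided_BM M X \<longleftrightarrow>
     prob_space M \<and>
     (\<forall>t. X t \<in> borel_measurable M) \<and>
     (AE \<omega> in M. X 0 \<omega> = 0) \<and>
     (AE \<omega> in M. continuous_on UNIV (\<lambda>t. X t \<omega>)) \<and>
     (\<forall>s t. s < t \<longrightarrow>
        distributed M lborel (\<lambda>\<omega>. X t \<omega> - X s \<omega>) (normal_density 0 (sqrt (t - s)))) \<and>
     (\<forall>(n::nat) t. strict_mono_on {..n} t \<longrightarrow>
        prob_space.indep_vars M (\<lambda>_. borel) (\<lambda>i \<omega>. X (t (Suc i)) \<omega> - X (t i) \<omega>) {..<n})"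

text \<open>The law \<open>\<P>\<^sub>0\<close> on path space. The finite-dimensional distributions determine it, so at
  most one measure satisfies this predicate.\<close>

definition is_BM_law :: "(real \<Rightarrow> real) measure \<Rightarrow> bool" where
  "is_BM_law P \<longleftrightarrow> sets P = sets path_space \<and> two_sided_BM P (\<lambda>t \<omega>. \<omega> t)"

definition random_time :: "((real \<Rightarrow> real) \<Rightarrow> real) \<Rightarrow> bool" where
  "random_time T \<longleftrightarrow> T \<in> path_space \<rightarrow>\<^sub>M borel"

text \<open>Independence of the shifted path and of \<open>B\<^sub>T\<close> is stated for the \<open>\<sigma>\<close>-algebras they
  generate, because \<^const>\<open>prob_space.indep_var\<close> needs both random elements to have the same
  type.\<close>

definition unbiased_shift ::
    "(real \<Rightarrow> real) measure \<Rightarrow> ((real \<Rightarrow> real) \<Rightarrow> real) \<Rightarrow> bool" where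
  "unbiased_shift P T \<longleftrightarrow>
     random_time T \<and>
     two_sided_BM P (\<lambda>t \<omega>. \<omega> (T \<omega> + t) - \<omega> (T \<omega>)) \<and>
     prob_space.indep_set P
       (sets (vimage_algebra (space P)
          (\<lambda>\<omega> t. \<omega> (T \<omega> + t) - \<omega> (T \<omega>)) path_space))
       (sets (vimage_algebra (space P) (\<lambda>\<omega>. \<omega> (T \<omega>)) borel))"

definition embeds ::
    "(real \<Rightarrow> real) measure \<Rightarrow> ((real \<Rightarrow> real) \<Rightarrow> real) \<Rightarrow> real measure \<Rightarrow> bool" where
  "embeds P T \<nu> \<longleftrightarrow> distr P borel (\<lambda>\<omega>. \<omega> (T \<omega>)) = \<nu>"

end

theory Submission
  imports Defs "HOL-Real_Asymp.Real_Asymp"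
begin

text \<open>
  Let \<open>0 < e \<le> 1\<close> and \<open>k = e\<^sup>2\<close>. For a killing rate \<open>h \<ge> 0\<close> let \<open>\<Phi>(w)\<close> be the probability that the
  path \<open>w\<close> survives on both sides of time \<open>0\<close>, each for an independent exponential time of rate
  \<open>k\<close>. Shifting the path by \<open>u\<close> changes \<open>\<Phi>\<close> by at most \<open>min 1 (e\<^sup>2 \<bar>u\<bar>)\<close>, whatever \<open>w\<close> and \<open>h\<close>
  are. If \<open>T\<close> is an unbiased shift and \<open>Y = B\<^sub>T\<close>, the path seen from \<open>T\<close> is a Brownian motion
  started at the independent point \<open>Y\<close>. By independence of past and future the mean of \<open>\<Phi>\<close> under a
  Brownian motion started at \<open>x\<close> is \<open>v(x)\<^sup>2\<close>, where \<open>v\<close> is the mean of one factor, hence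
  \<open>\<E>\<^sub>0 [v(Y)\<^sup>2 - v(0)\<^sup>2] \<le> \<E>\<^sub>0 (min 1 (e\<^sup>2 \<bar>T\<bar>))\<close>.

  For a suitable \<open>h\<close>, depending on \<open>e\<close>, the function \<open>v\<close> is explicit and
  \<open>v(x)\<^sup>2 - v(0)\<^sup>2 \<ge> e d(x)\<close> with \<open>d\<close> independent of \<open>e\<close> and positive off \<open>0\<close>. Dividing by \<open>e\<close>,
  \<open>\<E>\<^sub>0 d(Y) \<le> \<E>\<^sub>0 (min (1/e) (e \<bar>T\<bar>))\<close>. The right-hand integrand is at most \<open>sqrt \<bar>T\<bar>\<close> and tends
  to \<open>0\<close> as \<open>e \<rightarrow> 0\<close>; so if \<open>sqrt \<bar>T\<bar>\<close> were integrable, dominated convergence would give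
  \<open>\<E>\<^sub>0 d(Y) = 0\<close> and \<open>Y = 0\<close> almost surely.
\<close>

subsection \<open>Path space and Brownian motion\<close>

lemma space_path_space: "space path_space = {w. continuous_on UNIV w}"
  by (simp add: path_space_def space_restrict_space space_PiM PiE_def)

lemma measurable_path_spaceI:
  assumes "\<And>t. (\<lambda>x. f x t) \<in> borel_measurable N"
    and "\<And>x. x \<in> space N \<Longrightarrow> continuous_on UNIV (f x)"
  shows "f \<in> N \<rightarrow>\<^sub>M path_space"
  unfolding path_space_def
proof (rule measurable_restrict_space2)
  show "f \<in> space N \<rightarrow> {\<omega>. continuous_on UNIV \<omega>}"
    using assms(2) by auto
  show "f \<in> N \<rightarrow>\<^sub>M Pi\<^sub>M UNIV (\<lambda>_. borel)"
    using measurable_abs_UNIV[of "\<lambda>t x. f x t" N "\<lambda>_. borel"] assms(1) by simp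
qed

lemma measurable_path_coord: "(\<lambda>w. w t) \<in> borel_measurable path_space"
  unfolding path_space_def
  by (rule measurable_restrict_space1) (rule measurable_component_singleton, simp)

lemma floor_grid_tendsto:
  fixes t :: real
  shows "(\<lambda>n. real_of_int \<lfloor>real (Suc n) * t\<rfloor> / real (Suc n)) \<longlonglongrightarrow> t"
proof (rule tendsto_sandwich)
  show "\<forall>\<^sub>F n in sequentially. t - 1 / real (Suc n) \<le> real_of_int \<lfloor>real (Suc n) * t\<rfloor> / real (Suc n)"
  proof (rule always_eventually, rule allI)
    fix n
    have "real (Suc n) * t - 1 \<le> real_of_int \<lfloor>real (Suc n) * t\<rfloor>"
      by linarith
    then have "(real (Suc n) * t - 1) / real (Suc n) \<le> real_of_int \<lfloor>real (Suc n) * t\<rfloor> / real (Suc n)"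
      by (rule divide_right_mono) simp
    then show "t - 1 / real (Suc n) \<le> real_of_int \<lfloor>real (Suc n) * t\<rfloor> / real (Suc n)"
      by (simp add: diff_divide_distrib)
  qed
  show "\<forall>\<^sub>F n in sequentially. real_of_int \<lfloor>real (Suc n) * t\<rfloor> / real (Suc n) \<le> t"
  proof (rule always_eventually, rule allI)
    fix n
    have "real_of_int \<lfloor>real (Suc n) * t\<rfloor> / real (Suc n) \<le> (real (Suc n) * t) / real (Suc n)"
      by (rule divide_right_mono) (linarith, simp)
    then show "real_of_int \<lfloor>real (Suc n) * t\<rfloor> / real (Suc n) \<le> t"
      by simp
  qed
  show "(\<lambda>n. t - 1 / real (Suc n)) \<longlonglongrightarrow> t"
    using tendsto_diff[OF tendsto_const LIMSEQ_inverse_real_of_nat, of t]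
    by (simp add: inverse_eq_divide)
qed simp

text \<open>Continuity of the paths makes evaluation jointly measurable: it is the limit of
  evaluations at the grid points floor(n t) / n, and each of these is a countable case distinction
  over measurable coordinates.\<close>

lemma measurable_path_eval:
  "(\<lambda>p. fst p (snd p)) \<in> borel_measurable (path_space \<Otimes>\<^sub>M (borel :: real measure))"
proof (rule borel_measurable_LIMSEQ_real)
  fix p :: "(real \<Rightarrow> real) \<times> real" assume "p \<in> space (path_space \<Otimes>\<^sub>M borel)"
  then have "isCont (fst p) (snd p)"
    by (auto simp: space_pair_measure space_path_space continuous_on_eq_continuous_at)
  then show "(\<lambda>n. fst p (real_of_int \<lfloor>real (Suc n) * snd p\<rfloor> / real (Suc n))) \<longlonglongrightarrow> fst p (snd p)"
    by (rule isCont_tendsto_compose) (rule floor_grid_tendsto)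
next
  fix n
  show "(\<lambda>p. fst p (real_of_int \<lfloor>real (Suc n) * snd p\<rfloor> / real (Suc n)))
      \<in> borel_measurable (path_space \<Otimes>\<^sub>M (borel :: real measure))"
  proof (rule measurable_compose_countable[where f="\<lambda>i p. fst p (real_of_int i / real (Suc n))"
        and g="\<lambda>p. \<lfloor>real (Suc n) * snd p\<rfloor>"])
    show "(\<lambda>p. fst p (real_of_int i / real (Suc n))) \<in> borel_measurable (path_space \<Otimes>\<^sub>M borel)" for i
      by (rule measurable_compose[OF measurable_fst measurable_path_coord])
    show "(\<lambda>p. \<lfloor>real (Suc n) * snd p\<rfloor>) \<in> path_space \<Otimes>\<^sub>M borel \<rightarrow>\<^sub>M count_space UNIV"
      by measurable
  qed
qed

lemma measurable_path_eval':
  assumes "f \<in> N \<rightarrow>\<^sub>M path_space" and "g \<in> borel_measurable N"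
  shows "(\<lambda>x. f x (g x)) \<in> borel_measurable N"
proof -
  have "(\<lambda>x. (f x, g x)) \<in> N \<rightarrow>\<^sub>M path_space \<Otimes>\<^sub>M borel"
    using assms by (rule measurable_Pair)
  from measurable_compose[OF this measurable_path_eval] show ?thesis by simp
qed

lemma continuous_path:
  assumes "f \<in> N \<rightarrow>\<^sub>M path_space" and "x \<in> space N"
  shows "continuous_on UNIV (f x)"
  using measurable_space[OF assms] by (simp add: space_path_space)

text \<open>Independence makes the joint law of \<open>U\<close> and \<open>V\<close> the product of
  their laws, so Fubini applies to the bounded \<open>G\<close>: \<open>V\<close> is frozen while
  \<open>U\<close> is averaged over a separate sample point. The hypothesis is phrased for generated
  sigma-algebras, as in \<open>unbiased_shift\<close>, so \<open>U\<close> and \<open>V\<close> may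
  have different types.\<close>

lemma (in prob_space) indep_set_expectation:
  fixes G :: "'b \<times> 'c \<Rightarrow> real"
  assumes U[measurable]: "U \<in> M \<rightarrow>\<^sub>M N1" and V[measurable]: "V \<in> M \<rightarrow>\<^sub>M N2"
    and ind: "indep_set (sets (vimage_algebra (space M) U N1)) (sets (vimage_algebra (space M) V N2))"
    and G[measurable]: "G \<in> borel_measurable (N1 \<Otimes>\<^sub>M N2)"
    and bound: "\<And>p. p \<in> space (N1 \<Otimes>\<^sub>M N2) \<Longrightarrow> \<bar>G p\<bar> \<le> B"
  shows "(\<integral>\<omega>. G (U \<omega>, V \<omega>) \<partial>M) = (\<integral>\<omega>. (\<integral>\<omega>'. G (U \<omega>', V \<omega>) \<partial>M) \<partial>M)"
proof -
  interpret D1: prob_space "distr M N1 U" by (rule prob_space_distr) simp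
  interpret D2: prob_space "distr M N2 V" by (rule prob_space_distr) simp
  interpret P: pair_prob_space "distr M N1 U" "distr M N2 V" ..
  have eq: "distr M N1 U \<Otimes>\<^sub>M distr M N2 V = distr M (N1 \<Otimes>\<^sub>M N2) (\<lambda>\<omega>. (U \<omega>, V \<omega>))"
  proof (rule pair_measure_eqI)
    show "sets (distr M N1 U \<Otimes>\<^sub>M distr M N2 V) = sets (distr M (N1 \<Otimes>\<^sub>M N2) (\<lambda>\<omega>. (U \<omega>, V \<omega>)))"
      by (simp cong: sets_pair_measure_cong)
    fix A B assume "A \<in> sets (distr M N1 U)" "B \<in> sets (distr M N2 V)"
    then have [measurable]: "A \<in> sets N1" "B \<in> sets N2" by auto
    have "U -` A \<inter> space M \<in> sets (vimage_algebra (space M) U N1)"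
      "V -` B \<inter> space M \<in> sets (vimage_algebra (space M) V N2)"
      by (auto intro: in_vimage_algebra)
    from indep_setD[OF ind this]
    have "prob ((U -` A \<inter> space M) \<inter> (V -` B \<inter> space M)) = prob (U -` A \<inter> space M) * prob (V -` B \<inter> space M)" .
    moreover have "(\<lambda>\<omega>. (U \<omega>, V \<omega>)) -` (A \<times> B) \<inter> space M = (U -` A \<inter> space M) \<inter> (V -` B \<inter> space M)"
      by auto
    ultimately show "emeasure (distr M N1 U) A * emeasure (distr M N2 V) B =
        emeasure (distr M (N1 \<Otimes>\<^sub>M N2) (\<lambda>\<omega>. (U \<omega>, V \<omega>))) (A \<times> B)"
      by (simp add: emeasure_distr emeasure_eq_measure ennreal_mult'')
  qed unfold_locales
  have G': "G \<in> borel_measurable (distr M N1 U \<Otimes>\<^sub>M distr M N2 V)"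
    using G by (simp cong: measurable_cong_sets sets_pair_measure_cong)
  have int: "integrable (distr M N1 U \<Otimes>\<^sub>M distr M N2 V) G"
    by (rule P.integrable_const_bound[where B=B])
       (use bound G' in \<open>auto simp: space_pair_measure intro!: AE_I2\<close>)
  have "(\<integral>\<omega>. G (U \<omega>, V \<omega>) \<partial>M) = (\<integral>p. G p \<partial>distr M (N1 \<Otimes>\<^sub>M N2) (\<lambda>\<omega>. (U \<omega>, V \<omega>)))"
    by (subst integral_distr) auto
  also have "\<dots> = (\<integral>v. (\<integral>u. G (u, v) \<partial>distr M N1 U) \<partial>distr M N2 V)"
    using P.integral_snd[of "curry G"] int by (simp add: eq)
  also have "\<dots> = (\<integral>v. (\<integral>\<omega>'. G (U \<omega>', v) \<partial>M) \<partial>distr M N2 V)"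
    by (intro Bochner_Integration.integral_cong refl integral_distr) auto
  also have "\<dots> = (\<integral>\<omega>. (\<integral>\<omega>'. G (U \<omega>', V \<omega>) \<partial>M) \<partial>M)"
    by (rule integral_distr) measurable
  finally show ?thesis .
qed

section \<open>Brownian motions with continuous paths, under shift and reversal\<close>

text \<open>Continuity at every sample point, instead of almost every one, makes the sample paths
  genuine elements of \<open>path_space\<close>, so path functionals can be composed with them
  without discarding null sets.\<close>

definition continuous_BM :: "'a measure \<Rightarrow> (real \<Rightarrow> 'a \<Rightarrow> real) \<Rightarrow> bool" where
  "continuous_BM M X \<longleftrightarrow>
     two_sided_BM M X \<and> (\<forall>\<omega>\<in>space M. continuous_on UNIV (\<lambda>t. X t \<omega>))"

lemma continuous_BMD:
  assumes "continuous_BM M X"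
  shows "prob_space M" and "X t \<in> borel_measurable M" and "AE \<omega> in M. X 0 \<omega> = 0"
    and "\<omega> \<in> space M \<Longrightarrow> continuous_on UNIV (\<lambda>t. X t \<omega>)"
    and "s < t \<Longrightarrow> distributed M lborel (\<lambda>\<omega>. X t \<omega> - X s \<omega>) (normal_density 0 (sqrt (t - s)))"
    and "strict_mono_on {..n::nat} \<tau> \<Longrightarrow>
       prob_space.indep_vars M (\<lambda>_. borel) (\<lambda>i \<omega>. X (\<tau> (Suc i)) \<omega> - X (\<tau> i) \<omega>) {..<n}"
  using assms by (auto simp: continuous_BM_def two_sided_BM_def)

lemma continuous_BM_measurable_pair:
  assumes X: "continuous_BM M X"
  shows "(\<lambda>p. X (fst p) (snd p)) \<in> borel_measurable (borel \<Otimes>\<^sub>M M)"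
proof -
  have "(\<lambda>\<omega> t. X t \<omega>) \<in> M \<rightarrow>\<^sub>M path_space"
    using continuous_BMD(2,4)[OF X] by (intro measurable_path_spaceI)
  from measurable_compose[OF measurable_snd this]
  have "(\<lambda>p t. X t (snd p)) \<in> borel \<Otimes>\<^sub>M M \<rightarrow>\<^sub>M path_space" .
  from measurable_path_eval'[OF this measurable_fst] show ?thesis .
qed

text \<open>The relevant \<open>f\<close> are \<open>max s 0\<close> and \<open>- max s 0\<close>:
  future and past are both coded as paths on the whole line, constant for negative
  \<open>s\<close>.\<close>

lemma continuous_BM_path:
  assumes X: "continuous_BM M X" and f: "continuous_on UNIV f"
  shows "(\<lambda>\<omega> t. X (f t) \<omega> - X c \<omega>) \<in> M \<rightarrow>\<^sub>M path_space"
proof (rule measurable_path_spaceI)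
  show "(\<lambda>\<omega>. X (f t) \<omega> - X c \<omega>) \<in> borel_measurable M" for t
    using continuous_BMD(2)[OF X] by measurable
  show "continuous_on UNIV (\<lambda>t. X (f t) \<omega> - X c \<omega>)" if "\<omega> \<in> space M" for \<omega>
    using continuous_on_compose2[OF continuous_BMD(4)[OF X that] f]
    by (intro continuous_intros) auto
qed

lemma continuous_BM_shift:
  assumes X: "continuous_BM M X"
  shows "continuous_BM M (\<lambda>t \<omega>. X (r + t) \<omega> - X r \<omega>)"
  unfolding continuous_BM_def two_sided_BM_def
proof (intro conjI allI impI ballI)
  note [measurable] = continuous_BMD(2)[OF X]
  show "prob_space M" by (rule continuous_BMD(1)[OF X])
  show "(\<lambda>\<omega>. X (r + t) \<omega> - X r \<omega>) \<in> borel_measurable M" for t by measurable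
  show c: "continuous_on UNIV (\<lambda>t. X (r + t) \<omega> - X r \<omega>)" if "\<omega> \<in> space M" for \<omega>
    by (intro continuous_intros continuous_on_compose2[OF continuous_BMD(4)[OF X that]]) auto
  then show "AE \<omega> in M. continuous_on UNIV (\<lambda>t. X (r + t) \<omega> - X r \<omega>)" by simp
  show "distributed M lborel (\<lambda>\<omega>. X (r + t) \<omega> - X r \<omega> - (X (r + s) \<omega> - X r \<omega>))
      (normal_density 0 (sqrt (t - s)))" if "s < t" for s t
    using continuous_BMD(5)[OF X, of "r + s" "r + t"] that by simp
  show "prob_space.indep_vars M (\<lambda>_. borel)
      (\<lambda>i \<omega>. X (r + \<tau> (Suc i)) \<omega> - X r \<omega> - (X (r + \<tau> i) \<omega> - X r \<omega>)) {..<n}"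
    if "strict_mono_on {..n} \<tau>" for n :: nat and \<tau>
    using continuous_BMD(6)[OF X, of n "\<lambda>i. r + \<tau> i"] that by (simp add: strict_mono_on_def)
qed auto

text \<open>Serves to list increments in reverse order. An injective relabelling sends finite
  subfamilies to finite subfamilies, so the product rule carries over.\<close>

lemma (in prob_space) indep_vars_reindex:
  assumes ind: "indep_vars M' X (f ` I)" and f: "inj_on f I"
  shows "indep_vars (\<lambda>i. M' (f i)) (\<lambda>i. X (f i)) I"
  unfolding indep_vars_def2
proof (intro conjI ballI indep_setsI)
  show "random_variable (M' (f i)) (X (f i))" if "i \<in> I" for i
    using ind that by (auto simp: indep_vars_def2)
  show "{X (f i) -` A \<inter> space M |A. A \<in> sets (M' (f i))} \<subseteq> events" if "i \<in> I" for i
    using ind that by (auto simp: indep_vars_def2 intro: measurable_sets)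
  fix A J assume J: "J \<noteq> {}" "J \<subseteq> I" "finite J"
    and A: "\<forall>j\<in>J. A j \<in> {X (f j) -` A \<inter> space M |A. A \<in> sets (M' (f j))}"
  have inj: "inj_on f J" using f J(2) by (rule inj_on_subset)
  define A' where "A' = (\<lambda>k. A (the_inv_into J f k))"
  have A': "A' (f j) = A j" if "j \<in> J" for j
    using that inj by (simp add: A'_def the_inv_into_f_f)
  have "prob (\<Inter>k\<in>f ` J. A' k) = (\<Prod>k\<in>f ` J. prob (A' k))"
    using ind J A A'
    by (intro indep_setsD[of "\<lambda>i. {X i -` A \<inter> space M |A. A \<in> sets (M' i)}" "f ` I"])
      (auto simp: indep_vars_def2)
  then show "prob (\<Inter>j\<in>J. A j) = (\<Prod>j\<in>J. prob (A j))"
    using A' by (simp add: prod.reindex[OF inj])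
qed

lemma continuous_BM_reverse:
  assumes X: "continuous_BM M X"
  shows "continuous_BM M (\<lambda>t. X (- t))"
  unfolding continuous_BM_def two_sided_BM_def
proof (intro conjI allI impI ballI)
  interpret prob_space M by (rule continuous_BMD(1)[OF X])
  note [measurable] = continuous_BMD(2)[OF X]
  show "prob_space M" by (rule continuous_BMD(1)[OF X])
  show "X (- t) \<in> borel_measurable M" for t by measurable
  show "AE \<omega> in M. X (- 0) \<omega> = 0" using continuous_BMD(3)[OF X] by simp
  show c: "continuous_on UNIV (\<lambda>t. X (- t) \<omega>)" if "\<omega> \<in> space M" for \<omega>
    by (intro continuous_intros continuous_on_compose2[OF continuous_BMD(4)[OF X that]]) auto
  then show "AE \<omega> in M. continuous_on UNIV (\<lambda>t. X (- t) \<omega>)" by simp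
  show "distributed M lborel (\<lambda>\<omega>. X (- t) \<omega> - X (- s) \<omega>) (normal_density 0 (sqrt (t - s)))"
    if "s < t" for s t
    using normal_density_affine[OF continuous_BMD(5)[OF X, of "- t" "- s"], of "- 1" 0] that
    by (simp add: algebra_simps)
  show "indep_vars (\<lambda>_. borel) (\<lambda>i \<omega>. X (- \<tau> (Suc i)) \<omega> - X (- \<tau> i) \<omega>) {..<n}"
    if \<tau>: "strict_mono_on {..n} \<tau>" for n :: nat and \<tau>
  proof -
    \<comment> \<open>Negating the times and reversing their order gives an increasing sequence
      again. Increment \<open>i\<close> of the reversed process is minus increment
      \<open>n - Suc i\<close> of \<open>X\<close> along \<open>\<tau>'\<close>.\<close>
    define \<tau>' where "\<tau>' = (\<lambda>i. - \<tau> (n - i))"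
    have "strict_mono_on {..n} \<tau>'"
      using \<tau> by (auto simp: strict_mono_on_def \<tau>'_def)
    from continuous_BMD(6)[OF X this]
    have "indep_vars (\<lambda>_. borel) (\<lambda>i \<omega>. - (X (\<tau>' (Suc i)) \<omega> - X (\<tau>' i) \<omega>)) {..<n}"
      by (rule indep_vars_compose2) simp
    moreover have "{..<n} = (\<lambda>i. n - Suc i) ` {..<n}"
    proof (intro set_eqI iffI)
      fix j assume "j \<in> {..<n}"
      then show "j \<in> (\<lambda>i. n - Suc i) ` {..<n}"
        by (intro image_eqI[where x="n - Suc j"]) auto
    qed auto
    moreover have "inj_on (\<lambda>i. n - Suc i) {..<n}"
      by (auto simp: inj_on_def)
    ultimately have "indep_vars (\<lambda>_. borel)
        (\<lambda>i \<omega>. - (X (\<tau>' (Suc (n - Suc i))) \<omega> - X (\<tau>' (n - Suc i)) \<omega>)) {..<n}"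
      using indep_vars_reindex[of "\<lambda>_. borel"
        "\<lambda>i \<omega>. - (X (\<tau>' (Suc i)) \<omega> - X (\<tau>' i) \<omega>)" "\<lambda>i. n - Suc i" "{..<n}"] by simp
    then show ?thesis
      by (rule indep_vars_cong[THEN iffD1, rotated -1]) (auto simp: \<tau>'_def Suc_diff_Suc)
  qed
qed

section \<open>Independence of past and future\<close>

text \<open>The pi-system of finite-dimensional events, on which independence is checked before it
  is extended to sigma-algebras.\<close>

definition cylinders :: "'a set \<Rightarrow> ('t \<Rightarrow> 'a \<Rightarrow> real) \<Rightarrow> 't set \<Rightarrow> 'a set set" where
  "cylinders \<Omega> Z T =
     {{\<omega>\<in>\<Omega>. \<forall>s\<in>S. Z s \<omega> \<in> A s} | S A. finite S \<and> S \<subseteq> T \<and> (\<forall>s. A s \<in> sets borel)}"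

lemma cylindersE:
  assumes "a \<in> cylinders \<Omega> Z T"
  obtains S A where "a = {\<omega>\<in>\<Omega>. \<forall>s\<in>S. Z s \<omega> \<in> A s}" "finite S" "S \<subseteq> T" "\<forall>s. A s \<in> sets borel"
  using assms unfolding cylinders_def by auto

lemma Int_stable_cylinders: "Int_stable (cylinders \<Omega> Z T)"
proof (rule Int_stableI)
  fix a b assume "a \<in> cylinders \<Omega> Z T" "b \<in> cylinders \<Omega> Z T"
  from this(1) obtain S A where S: "a = {\<omega>\<in>\<Omega>. \<forall>s\<in>S. Z s \<omega> \<in> A s}" "finite S" "S \<subseteq> T"
      "\<forall>s. A s \<in> sets borel"
    by (rule cylindersE)
  from \<open>b \<in> cylinders \<Omega> Z T\<close> obtain S' A' where S': "b = {\<omega>\<in>\<Omega>. \<forall>s\<in>S'. Z s \<omega> \<in> A' s}"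
      "finite S'" "S' \<subseteq> T" "\<forall>s. A' s \<in> sets borel"
    by (rule cylindersE)
  \<comment> \<open>Times constrained by only one of the two events are padded with
    \<open>UNIV\<close>, so a single family over the union of the time sets describes the
    intersection.\<close>
  define A'' where "A'' = (\<lambda>s. (if s \<in> S then A s else UNIV) \<inter> (if s \<in> S' then A' s else UNIV))"
  have "a \<inter> b = {\<omega>\<in>\<Omega>. \<forall>s\<in>S \<union> S'. Z s \<omega> \<in> A'' s}"
    unfolding S(1) S'(1) A''_def by (auto split: if_splits)
  moreover have "finite (S \<union> S')" "S \<union> S' \<subseteq> T" "\<forall>s. A'' s \<in> sets borel"
    using S S' by (auto simp: A''_def)
  ultimately show "a \<inter> b \<in> cylinders \<Omega> Z T"
    unfolding cylinders_def by blast
qed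

text \<open>The coordinates generate \<open>path_space\<close>, so a path that reads
  \<open>Z\<close> only at times in \<open>T\<close> is measurable for the sigma-algebra generated
  by the cylinders over \<open>T\<close>.\<close>

lemma vimage_path_space_cylinders:
  assumes "\<And>\<omega>. \<omega> \<in> \<Omega> \<Longrightarrow> continuous_on UNIV (\<lambda>t. Z (f t) \<omega>)" and "range f \<subseteq> T"
  shows "sets (vimage_algebra \<Omega> (\<lambda>\<omega> t. Z (f t) \<omega>) path_space) \<subseteq> sigma_sets \<Omega> (cylinders \<Omega> Z T)"
proof -
  have sub: "cylinders \<Omega> Z T \<subseteq> Pow \<Omega>" by (auto simp: cylinders_def)
  have "(\<lambda>\<omega> t. Z (f t) \<omega>) \<in> sigma \<Omega> (cylinders \<Omega> Z T) \<rightarrow>\<^sub>M path_space"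
  proof (rule measurable_path_spaceI)
    fix t
    show "(\<lambda>\<omega>. Z (f t) \<omega>) \<in> borel_measurable (sigma \<Omega> (cylinders \<Omega> Z T))"
    proof (rule measurableI)
      fix B :: "real set" assume "B \<in> sets borel"
      then have "{\<omega>\<in>\<Omega>. \<forall>s\<in>{f t}. Z s \<omega> \<in> B} \<in> cylinders \<Omega> Z T"
        unfolding cylinders_def using assms(2)
        by (intro CollectI exI[where x="{f t}"] exI[where x="\<lambda>_. B"]) auto
      then show "(\<lambda>\<omega>. Z (f t) \<omega>) -` B \<inter> space (sigma \<Omega> (cylinders \<Omega> Z T))
          \<in> sets (sigma \<Omega> (cylinders \<Omega> Z T))"
        using sub by (auto simp: Int_def vimage_def conj_commute)
    qed simp
  qed (use assms(1) sub in auto)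
  then have "(\<lambda>\<omega> t. Z (f t) \<omega>) -` B \<inter> \<Omega> \<in> sigma_sets \<Omega> (cylinders \<Omega> Z T)"
    if "B \<in> sets path_space" for B
    using measurable_sets[OF _ that, of _ "sigma \<Omega> (cylinders \<Omega> Z T)"] sub by simp
  moreover have "(\<lambda>\<omega> t. Z (f t) \<omega>) \<in> \<Omega> \<rightarrow> space path_space"
    using assms(1) by (auto simp: space_path_space)
  ultimately show ?thesis
    by (auto simp: sets_vimage_algebra2)
qed

text \<open>Both events are expressed through the increments along the finitely many times involved,
  split at time \<open>0\<close>.\<close>

lemma continuous_BM_indep_cylinders:
  assumes X: "continuous_BM M X"
    and a: "a \<in> cylinders (space M) (\<lambda>t \<omega>. X t \<omega> - X 0 \<omega>) {0..}"
    and b: "b \<in> cylinders (space M) (\<lambda>t \<omega>. X t \<omega> - X 0 \<omega>) {..0}"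
  shows "measure M (a \<inter> b) = measure M a * measure M b"
proof -
  interpret prob_space M by (rule continuous_BMD(1)[OF X])
  obtain S A where a_eq: "a = {\<omega>\<in>space M. \<forall>s\<in>S. X s \<omega> - X 0 \<omega> \<in> A s}"
    and S: "finite S" "S \<subseteq> {0..}" and A: "\<forall>s. A s \<in> sets borel"
    using a by (rule cylindersE)
  obtain S' B where b_eq: "b = {\<omega>\<in>space M. \<forall>s\<in>S'. X s \<omega> - X 0 \<omega> \<in> B s}"
    and S': "finite S'" "S' \<subseteq> {..0}" and B: "\<forall>s. B s \<in> sets borel"
    using b by (rule cylindersE)
  \<comment> \<open>Time 0 is inserted so that it is one of the partition points, namely
    \<open>\<tau> m\<close>: increments with index below \<open>m\<close> belong to the past, the
    others to the future.\<close>
  define l where "l = sorted_list_of_set (insert 0 (S \<union> S'))"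
  define \<tau> where "\<tau> = (\<lambda>i. l ! i)"
  define n where "n = length l - 1"
  have set_l: "set l = insert 0 (S \<union> S')" using S S' 
    unfolding l_def by (intro set_sorted_list_of_set) simp
  then have "l \<noteq> []" by auto
  then have len: "length l = Suc n" by (simp add: n_def)
  have mono: "strict_mono_on {..n} \<tau>"
    using sorted_wrt_nth_less[of "(<)" l] len
    by (auto simp: strict_mono_on_def \<tau>_def l_def)
  have rng: "\<exists>i\<le>n. \<tau> i = s" if "s \<in> insert 0 (S \<union> S')" for s
    using that len unfolding set_l[symmetric] in_set_conv_nth by (auto simp: \<tau>_def less_Suc_eq_le)
  obtain m where m: "m \<le> n" "\<tau> m = 0" using rng[of 0] by auto
  define D where "D = (\<lambda>i \<omega>. X (\<tau> (Suc i)) \<omega> - X (\<tau> i) \<omega>)"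
  have "indep_vars (\<lambda>_. borel) D {..<n}"
    unfolding D_def by (rule continuous_BMD(6)[OF X mono])
  then have ind: "indep_var (\<Pi>\<^sub>M i\<in>{m..<n}. borel) (\<lambda>\<omega>. \<lambda>i\<in>{m..<n}. D i \<omega>)
     (\<Pi>\<^sub>M i\<in>{..<m}. borel) (\<lambda>\<omega>. \<lambda>i\<in>{..<m}. D i \<omega>)"
    by (rule indep_var_restrict) (use m(1) in auto)
  have le: "i \<le> j" if "\<tau> i \<le> \<tau> j" "i \<le> n" "j \<le> n" for i j
    using strict_mono_onD[OF mono, of j i] that by (cases "i \<le> j") auto
  have fut: "X (\<tau> i) \<omega> - X 0 \<omega> = (\<Sum>j\<in>{m..<i}. D j \<omega>)" if "m \<le> i" for i \<omega>
    unfolding D_def using sum_Suc_diff'[OF that, of "\<lambda>i. X (\<tau> i) \<omega>"] m by simp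
  \<comment> \<open>The sum runs from the earlier time up to 0, hence the minus sign.\<close>
  have past: "X (\<tau> i) \<omega> - X 0 \<omega> = - (\<Sum>j\<in>{i..<m}. D j \<omega>)" if "i \<le> m" for i \<omega>
    unfolding D_def using sum_Suc_diff'[OF that, of "\<lambda>i. X (\<tau> i) \<omega>"] m by simp
  \<comment> \<open>\<open>EA\<close> and \<open>EB\<close> are the two events rewritten as
    conditions on the disjoint blocks of future and past increments.\<close>
  define EA where "EA = {g \<in> space (\<Pi>\<^sub>M i\<in>{m..<n}. borel :: real measure).
    \<forall>i\<in>{i\<in>{m..n}. \<tau> i \<in> S}. (\<Sum>j\<in>{m..<i}. g j) \<in> A (\<tau> i)}"
  define EB where "EB = {g \<in> space (\<Pi>\<^sub>M i\<in>{..<m}. borel :: real measure).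
    \<forall>i\<in>{i\<in>{..m}. \<tau> i \<in> S'}. - (\<Sum>j\<in>{i..<m}. g j) \<in> B (\<tau> i)}"
  have EA: "EA \<in> sets (\<Pi>\<^sub>M i\<in>{m..<n}. borel)"
    unfolding EA_def
  proof (rule sets.sets_Collect_finite_All)
    fix i assume "i \<in> {i \<in> {m..n}. \<tau> i \<in> S}"
    then have "(\<lambda>g. \<Sum>j\<in>{m..<i}. g j) \<in> borel_measurable (\<Pi>\<^sub>M i\<in>{m..<n}. borel :: real measure)"
      by (intro borel_measurable_sum measurable_component_singleton) auto
    from measurable_sets[OF this A[rule_format, of "\<tau> i"]]
    show "{g \<in> space (\<Pi>\<^sub>M i\<in>{m..<n}. borel). (\<Sum>j\<in>{m..<i}. g j) \<in> A (\<tau> i)} \<in> sets (\<Pi>\<^sub>M i\<in>{m..<n}. borel)"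
      by (simp add: vimage_def Int_def conj_commute)
  qed simp
  have EB: "EB \<in> sets (\<Pi>\<^sub>M i\<in>{..<m}. borel)"
    unfolding EB_def
  proof (rule sets.sets_Collect_finite_All)
    fix i assume "i \<in> {i \<in> {..m}. \<tau> i \<in> S'}"
    then have "(\<lambda>g. - (\<Sum>j\<in>{i..<m}. g j)) \<in> borel_measurable (\<Pi>\<^sub>M i\<in>{..<m}. borel :: real measure)"
      by (intro borel_measurable_uminus borel_measurable_sum measurable_component_singleton) auto
    from measurable_sets[OF this B[rule_format, of "\<tau> i"]]
    show "{g \<in> space (\<Pi>\<^sub>M i\<in>{..<m}. borel). - (\<Sum>j\<in>{i..<m}. g j) \<in> B (\<tau> i)} \<in> sets (\<Pi>\<^sub>M i\<in>{..<m}. borel)"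
      by (simp add: vimage_def Int_def conj_commute)
  qed simp
  have in_EA: "(\<lambda>i\<in>{m..<n}. D i \<omega>) \<in> EA \<longleftrightarrow> (\<forall>s\<in>S. X s \<omega> - X 0 \<omega> \<in> A s)" for \<omega>
  proof -
    have sums: "(\<Sum>j\<in>{m..<i}. (\<lambda>i\<in>{m..<n}. D i \<omega>) j) = X (\<tau> i) \<omega> - X 0 \<omega>" if "i \<in> {m..n}" for i
      using that fut[of i \<omega>] by (auto intro!: sum.cong)
    have "(\<lambda>i\<in>{m..<n}. D i \<omega>) \<in> EA \<longleftrightarrow> (\<forall>i\<in>{i\<in>{m..n}. \<tau> i \<in> S}. X (\<tau> i) \<omega> - X 0 \<omega> \<in> A (\<tau> i))"
      unfolding EA_def using sums by (auto simp: space_PiM)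
    also have "\<dots> \<longleftrightarrow> (\<forall>s\<in>S. X s \<omega> - X 0 \<omega> \<in> A s)"
    proof (intro iffI ballI)
      fix s assume *: "\<forall>i\<in>{i\<in>{m..n}. \<tau> i \<in> S}. X (\<tau> i) \<omega> - X 0 \<omega> \<in> A (\<tau> i)" and s: "s \<in> S"
      then obtain i where i: "i \<le> n" "\<tau> i = s" using rng[of s] by auto
      moreover have "m \<le> i" using le[of m i] m i S s by auto
      ultimately show "X s \<omega> - X 0 \<omega> \<in> A s" using * s by auto
    qed auto
    finally show ?thesis .
  qed
  have in_EB: "(\<lambda>i\<in>{..<m}. D i \<omega>) \<in> EB \<longleftrightarrow> (\<forall>s\<in>S'. X s \<omega> - X 0 \<omega> \<in> B s)" for \<omega>
  proof -
    have sums: "- (\<Sum>j\<in>{i..<m}. (\<lambda>i\<in>{..<m}. D i \<omega>) j) = X (\<tau> i) \<omega> - X 0 \<omega>" if "i \<in> {..m}" for i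
      using that past[of i \<omega>] by (auto intro!: sum.cong)
    have "(\<lambda>i\<in>{..<m}. D i \<omega>) \<in> EB \<longleftrightarrow> (\<forall>i\<in>{i\<in>{..m}. \<tau> i \<in> S'}. X (\<tau> i) \<omega> - X 0 \<omega> \<in> B (\<tau> i))"
      unfolding EB_def using sums by (auto simp: space_PiM)
    also have "\<dots> \<longleftrightarrow> (\<forall>s\<in>S'. X s \<omega> - X 0 \<omega> \<in> B s)"
    proof (intro iffI ballI)
      fix s assume *: "\<forall>i\<in>{i\<in>{..m}. \<tau> i \<in> S'}. X (\<tau> i) \<omega> - X 0 \<omega> \<in> B (\<tau> i)" and s: "s \<in> S'"
      then obtain i where i: "i \<le> n" "\<tau> i = s" using rng[of s] by auto
      moreover have "i \<le> m" using le[of i m] m i S' s by auto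
      ultimately show "X s \<omega> - X 0 \<omega> \<in> B s" using * s by auto
    qed auto
    finally show ?thesis .
  qed
  have "(\<lambda>\<omega>. \<lambda>i\<in>{m..<n}. D i \<omega>) -` EA \<inter> space M = a"
    "(\<lambda>\<omega>. \<lambda>i\<in>{..<m}. D i \<omega>) -` EB \<inter> space M = b"
    "(\<lambda>\<omega>. (\<lambda>i\<in>{m..<n}. D i \<omega>, \<lambda>i\<in>{..<m}. D i \<omega>)) -` (EA \<times> EB) \<inter> space M = a \<inter> b"
    using in_EA in_EB by (auto simp: a_eq b_eq)
  with indep_varD[OF ind EA EB] show ?thesis by simp
qed

text \<open>The product rule on cylinders extends to the generated sigma-algebras because cylinders
  are stable under intersection, and the future and past paths are measurable for these.\<close>

lemma continuous_BM_indep_past_future: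
  assumes X: "continuous_BM M X"
  shows "prob_space.indep_set M
     (sets (vimage_algebra (space M) (\<lambda>\<omega> s. X (max s 0) \<omega> - X 0 \<omega>) path_space))
     (sets (vimage_algebra (space M) (\<lambda>\<omega> s. X (- max s 0) \<omega> - X 0 \<omega>) path_space))"
proof -
  interpret prob_space M by (rule continuous_BMD(1)[OF X])
  let ?Z = "\<lambda>t \<omega>. X t \<omega> - X 0 \<omega>"
  have cyl: "cylinders (space M) ?Z T \<subseteq> events" for T
  proof
    fix a assume "a \<in> cylinders (space M) ?Z T"
    then obtain S A where a: "a = {\<omega>\<in>space M. \<forall>s\<in>S. ?Z s \<omega> \<in> A s}" "finite S" "S \<subseteq> T" and
      A: "\<forall>s. A s \<in> sets borel"
      by (rule cylindersE)
    note [measurable] = continuous_BMD(2)[OF X] A[rule_format]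
    show "a \<in> events" unfolding a(1)
      by (rule sets.sets_Collect_finite_All[OF _ a(2)]) measurable
  qed
  have "indep_set (cylinders (space M) ?Z {0..}) (cylinders (space M) ?Z {..0})"
    by (rule indep_setI[OF cyl cyl continuous_BM_indep_cylinders[OF X]])
  from indep_set_sigma_sets[OF this Int_stable_cylinders Int_stable_cylinders]
  have ind: "indep_set (sigma_sets (space M) (cylinders (space M) ?Z {0..}))
     (sigma_sets (space M) (cylinders (space M) ?Z {..0}))" .
  have cont: "continuous_on UNIV (\<lambda>t. X (f t) \<omega> - X 0 \<omega>)"
    if "\<omega> \<in> space M" "continuous_on UNIV f" for \<omega> and f :: "real \<Rightarrow> real"
    using continuous_path[OF continuous_BM_path[OF X that(2)] that(1)] .
  show ?thesis
    unfolding indep_set_def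
  proof (rule indep_sets_mono_sets[OF ind[unfolded indep_set_def]])
    fix i :: bool
    have "sets (vimage_algebra (space M) (\<lambda>\<omega> s. ?Z (max s 0) \<omega>) path_space)
        \<subseteq> sigma_sets (space M) (cylinders (space M) ?Z {0..})"
      by (rule vimage_path_space_cylinders[where Z="?Z" and f="\<lambda>s. max s 0"])
        (auto intro!: cont continuous_on_max continuous_on_id continuous_on_const)
    moreover have "sets (vimage_algebra (space M) (\<lambda>\<omega> s. ?Z (- max s 0) \<omega>) path_space)
        \<subseteq> sigma_sets (space M) (cylinders (space M) ?Z {..0})"
      by (rule vimage_path_space_cylinders[where Z="?Z" and f="\<lambda>s. - max s 0"])
        (auto intro!: cont continuous_on_minus continuous_on_max continuous_on_id continuous_on_const)
    ultimately show "(case i of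
        True \<Rightarrow> sets (vimage_algebra (space M) (\<lambda>\<omega> s. X (max s 0) \<omega> - X 0 \<omega>) path_space)
      | False \<Rightarrow> sets (vimage_algebra (space M) (\<lambda>\<omega> s. X (- max s 0) \<omega> - X 0 \<omega>) path_space))
      \<subseteq> (case i of True \<Rightarrow> sigma_sets (space M) (cylinders (space M) ?Z {0..})
      | False \<Rightarrow> sigma_sets (space M) (cylinders (space M) ?Z {..0}))"
      by (cases i) auto
  qed
qed

subsection \<open>The Feynman--Kac functional of a path\<close>

abbreviation exponential_law :: "real \<Rightarrow> real measure" where
  "exponential_law k \<equiv> density lborel (exponential_density k)"

text \<open>The probability that a particle following \<open>w\<close> and killed at rate \<open>h\<close> survives an independent
  exponential time of rate \<open>k\<close>.\<close>

definition feynman_kac :: "real \<Rightarrow> (real \<Rightarrow> real) \<Rightarrow> (real \<Rightarrow> real) \<Rightarrow> real" where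
  "feynman_kac k h w =
     (\<integral>q. exp (- (LINT r:{0..q}|lborel. h (w r))) \<partial>exponential_law k)"

lemma AE_exponential_law_nonneg: "AE q in exponential_law k. 0 \<le> q"
  by (simp add: AE_density erlang_density_def)

section \<open>Differentiation of the functional along time shifts\<close>

text \<open>Against Lebesgue measure the integrand is the derivative of \<open>F\<close> on the
  half-line and 0 elsewhere. It is nonnegative, so \<open>F\<close> increases to its limit and
  integrability comes as part of the conclusion.\<close>

lemma exponential_integral_FTC:
  assumes k: "0 < k" and f[measurable]: "f \<in> borel_measurable borel"
    and nonneg: "\<And>q. 0 \<le> q \<Longrightarrow> 0 \<le> f q"
    and F: "\<And>q. 0 \<le> q \<Longrightarrow> (F has_real_derivative k * exp (- (k * q)) * f q) (at q)"
    and lim: "(F \<longlongrightarrow> l) at_top"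
  shows "has_bochner_integral (exponential_law k) f (l - F 0)"
proof -
  have "F 0 \<le> F q" if "0 \<le> q" for q
    by (rule DERIV_nonneg_imp_nondecreasing[OF that])
       (rule exI, rule conjI, erule F, use k nonneg in auto)
  then have le: "F 0 \<le> l"
    using lim by (intro tendsto_lowerbound[OF lim]) (auto simp: eventually_at_top_linorder)
  have "(\<integral>\<^sup>+q. ennreal (k * exp (- (k * q)) * f q) * indicator {0..} q \<partial>lborel) = ennreal (l - F 0)"
    using k nonneg F by (intro nn_integral_FTC_atLeast[OF _ _ _ lim]) auto
  moreover have "(\<integral>\<^sup>+q. ennreal (f q) \<partial>exponential_law k) =
      (\<integral>\<^sup>+q. ennreal (k * exp (- (k * q)) * f q) * indicator {0..} q \<partial>lborel)"
  proof -
    have "ennreal (exponential_density k q) * ennreal (f q) =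
        ennreal (k * exp (- (k * q)) * f q) * indicator {0..} q" for q
      using k nonneg[of q]
      by (cases "0 \<le> q") (simp_all add: exponential_density_def ennreal_mult[symmetric] mult.commute)
    then show ?thesis by (simp add: nn_integral_density)
  qed
  ultimately have "(\<integral>\<^sup>+q. ennreal (f q) \<partial>exponential_law k) = ennreal (l - F 0)" by simp
  moreover have "AE q in exponential_law k. 0 \<le> f q"
    using AE_exponential_law_nonneg[of k] by eventually_elim (rule nonneg)
  ultimately show ?thesis
    using le by (intro has_bochner_integral_nn_integral) auto
qed

lemma continuous_antiderivative:
  fixes f :: "real \<Rightarrow> real"
  assumes "continuous_on UNIV f"
  obtains F where "\<And>x. (F has_real_derivative f x) (at x)"
proof -
  have "\<exists>F. \<forall>x::real. - \<infinity> < ereal x \<longrightarrow> ereal x < \<infinity> \<longrightarrow> (F has_vector_derivative f x) (at x)"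
    using assms by (intro einterval_antiderivative) (auto simp: continuous_on_eq_continuous_at)
  then show ?thesis
    using that by (auto simp: has_real_derivative_iff_has_vector_derivative)
qed

text \<open>\<open>A\<close> accumulates the killing along \<open>w\<close>, so a path started at
  time \<open>u\<close> collects \<open>A (u + q) - A u\<close> during a time \<open>q\<close>. One
  antiderivative serves all shifts, which makes the functional differentiable in
  \<open>u\<close>.\<close>

lemma feynman_kac_antiderivative:
  assumes w: "continuous_on UNIV w" and h: "continuous_on UNIV h"
    and A: "\<And>x. (A has_real_derivative h (w x)) (at x)"
  shows "feynman_kac k h (\<lambda>s. w (u + s)) = (\<integral>q. exp (A u - A (u + q)) \<partial>exponential_law k)"
  unfolding feynman_kac_def
proof (rule integral_cong_AE)
  have c: "continuous_on UNIV (\<lambda>q. A (u + q))"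
    using A by (intro continuous_at_imp_continuous_on ballI isCont_o2[of _ "\<lambda>q. u + q" A])
      (auto intro: DERIV_isCont)
  \<comment> \<open>For negative \<open>q\<close> the interval is empty and the left side is 1. The
    exponential law does not charge these \<open>q\<close>.\<close>
  have eq: "exp (- (LINT r:{0..q}|lborel. h (w (u + r)))) = (if 0 \<le> q then exp (A u - A (u + q)) else 1)" for q
  proof (cases "0 \<le> q")
    case True
    have "(LINT r:{0..q}|lborel. h (w (u + r))) = A (u + q) - A (u + 0)"
      unfolding set_lebesgue_integral_def
    proof (rule integral_FTC_atLeastAtMost[OF True])
      show "((\<lambda>x. A (u + x)) has_vector_derivative h (w (u + x))) (at x within {0..q})" for x
        unfolding has_real_derivative_iff_has_vector_derivative[symmetric]
        by (rule has_field_derivative_at_within)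
           (use DERIV_shift[of A "h (w (u + x))" x u] A in \<open>simp add: add.commute\<close>)
      show "continuous_on {0..q} (\<lambda>r. h (w (u + r)))"
        by (intro continuous_on_compose2[OF h] continuous_on_compose2[OF w] continuous_intros) auto
    qed
    then show ?thesis using True by simp
  qed (simp add: set_lebesgue_integral_def)
  have m: "(\<lambda>q. exp (A u - A (u + q))) \<in> borel_measurable borel"
    by (intro borel_measurable_continuous_onI continuous_intros c)
  then show "(\<lambda>q. exp (A u - A (u + q))) \<in> borel_measurable (exponential_law k)" by simp
  have "(\<lambda>q. if 0 \<le> q then exp (A u - A (u + q)) else 1) \<in> borel_measurable borel"
    by (rule measurable_If[OF m]) auto
  then show "(\<lambda>q. exp (- (LINT r:{0..q}|lborel. h (w (u + r))))) \<in> borel_measurable (exponential_law k)"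
    unfolding eq by simp
  show "AE q in exponential_law k. exp (- (LINT r:{0..q}|lborel. h (w (u + r)))) = exp (A u - A (u + q))"
    using AE_exponential_law_nonneg[of k] unfolding eq by eventually_elim simp
qed

text \<open>Substituting s = u + q turns the functional into k exp(k u + A u) times the integral of
  exp(- k s - A s) over s \<ge> u. In the product rule the prefactor contributes k + h(w u) times
  the functional and the moving endpoint contributes - k.\<close>

lemma feynman_kac_has_derivative:
  assumes k: "0 < k" and w: "continuous_on UNIV w" and h: "continuous_on UNIV h"
    and nonneg: "\<And>x. 0 \<le> h x"
  shows "((\<lambda>u. feynman_kac k h (\<lambda>s. w (u + s))) has_real_derivative
    (k + h (w u)) * feynman_kac k h (\<lambda>s. w (u + s)) - k) (at u)"
proof -
  have hw: "continuous_on UNIV (\<lambda>s. h (w s))"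
    by (intro continuous_on_compose2[OF h w]) auto
  then obtain A where A: "\<And>x. (A has_real_derivative h (w x)) (at x)"
    by (rule continuous_antiderivative) blast
  have A_cont: "continuous_on UNIV A"
    using A by (auto intro!: continuous_at_imp_continuous_on DERIV_isCont)
  have A_mono: "A x \<le> A y" if "x \<le> y" for x y
    using DERIV_nonneg_imp_nondecreasing[OF that, of A] A nonneg by blast
  define e where "e = (\<lambda>s. exp (- (k * s) - A s))"
  have "continuous_on UNIV e" unfolding e_def by (intro continuous_intros A_cont)
  then obtain E where E: "\<And>x. (E has_real_derivative e x) (at x)"
    by (rule continuous_antiderivative) blast
  have E_mono: "E x \<le> E y" if "x \<le> y" for x y
    by (rule DERIV_nonneg_imp_nondecreasing[OF that]) (rule exI, rule conjI, rule E, simp add: e_def)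
  \<comment> \<open>Since \<open>A\<close> is nondecreasing, \<open>e s\<close> is at most exp(- A
    0) exp(- k s) for s \<ge> 0. The auxiliary \<open>?G\<close> adds to \<open>E\<close> the
    remaining tail of this majorant and is therefore nonincreasing.\<close>
  have E_bound: "E x \<le> E 0 + exp (- A 0) / k" if "0 \<le> x" for x
  proof -
    let ?G = "\<lambda>x. E x + exp (- A 0) / k * exp (- (k * x))"
    have "?G x \<le> ?G 0"
    proof (rule DERIV_nonpos_imp_nonincreasing[OF that])
      fix y assume y: "0 \<le> y" "y \<le> x"
      have "(?G has_real_derivative e y - exp (- A 0) * exp (- (k * y))) (at y)"
        using k by (auto intro!: derivative_eq_intros E)
      moreover have "e y \<le> exp (- A 0) * exp (- (k * y))"
        using A_mono[OF y(1)] by (simp add: e_def exp_add[symmetric])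
      ultimately show "\<exists>z. (?G has_real_derivative z) (at y) \<and> z \<le> 0" by force
    qed
    moreover have "0 \<le> exp (- A 0) / k * exp (- (k * x))" using k by simp
    ultimately show ?thesis by simp
  qed
  define l where "l = Sup (range E)"
  have bdd: "bdd_above (range E)"
  proof (rule bdd_aboveI2)
    show "E x \<le> E 0 + exp (- A 0) / k" for x
      using E_bound[of "max x 0"] E_mono[of x "max x 0"] by simp
  qed
  have lim: "(E \<longlongrightarrow> l) at_top"
  proof (rule increasing_tendsto)
    show "\<forall>\<^sub>F x in at_top. E x \<le> l" unfolding l_def by (simp add: cSup_upper[OF _ bdd])
    fix y assume "y < l"
    then obtain z where "y < E z" unfolding l_def by (auto simp: less_cSup_iff[OF _ bdd])
    then show "\<forall>\<^sub>F x in at_top. y < E x"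
      unfolding eventually_at_top_linorder using E_mono less_le_trans by blast
  qed
  have eq: "feynman_kac k h (\<lambda>s. w (u + s)) = k * exp (k * u + A u) * (l - E u)" for u
  proof -
    let ?c = "k * exp (k * u + A u)"
    have "feynman_kac k h (\<lambda>s. w (u + s)) = (\<integral>q. exp (A u - A (u + q)) \<partial>exponential_law k)"
      by (rule feynman_kac_antiderivative[OF w h A])
    also have "\<dots> = ?c * l - ?c * E (u + 0)"
    proof (rule has_bochner_integral_integral_eq, rule exponential_integral_FTC[OF k])
      have "continuous_on UNIV (\<lambda>q. A (u + q))"
        by (intro continuous_on_compose2[OF A_cont] continuous_intros) auto
      then show "(\<lambda>q. exp (A u - A (u + q))) \<in> borel_measurable borel"
        by (intro borel_measurable_continuous_onI continuous_intros)
      show "((\<lambda>q. ?c * E (u + q)) has_real_derivative k * exp (- (k * q)) * exp (A u - A (u + q))) (at q)" for q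
      proof -
        have "((\<lambda>q. E (u + q)) has_real_derivative e (u + q)) (at q)"
          using DERIV_shift[of E "e (u + q)" q u] E by (simp add: add.commute)
        from DERIV_cmult[OF this, of ?c] show ?thesis
          by (simp add: e_def exp_add[symmetric] algebra_simps)
      qed
      have "filterlim (\<lambda>q. u + q) at_top at_top"
        by (rule filterlim_tendsto_add_at_top[OF tendsto_const filterlim_ident])
      from tendsto_mult_left[OF filterlim_compose[OF lim this], of ?c]
      show "((\<lambda>q. ?c * E (u + q)) \<longlongrightarrow> ?c * l) at_top" .
    qed simp
    finally show ?thesis by (simp add: algebra_simps)
  qed
  have "((\<lambda>u. k * exp (k * u + A u) * (l - E u)) has_real_derivative
      (k + h (w u)) * (k * exp (k * u + A u) * (l - E u)) - k) (at u)"
    using E A by (auto intro!: derivative_eq_intros simp: e_def exp_add[symmetric] algebra_simps)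
  then show ?thesis unfolding eq .
qed

lemma feynman_kac_bounds:
  assumes k: "0 < k" and nonneg: "\<And>x. 0 \<le> h x"
  shows "0 \<le> feynman_kac k h w" and "feynman_kac k h w \<le> 1"
proof -
  interpret prob_space "exponential_law k" by (rule prob_space_exponential_density[OF k])
  show "0 \<le> feynman_kac k h w" unfolding feynman_kac_def by simp
  have "0 \<le> (LINT r:{0..q}|lborel. h (w r))" for q
    unfolding set_lebesgue_integral_def using nonneg by simp
  \<comment> \<open>When the integrand is not integrable, the Bochner integral is 0 by convention,
    which also satisfies the bound.\<close>
  then show "feynman_kac k h w \<le> 1"
    unfolding feynman_kac_def
    by (cases "integrable (exponential_law k) (\<lambda>q. exp (- (LINT r:{0..q}|lborel. h (w r))))")
       (auto intro!: integral_le_const simp: not_integrable_integral_eq)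
qed

text \<open>This is the Feynman--Kac equation before averaging. With S(u) the functional of the path
  shifted by u, the derivative formula shows that - exp(- k u) (1 - S(u)) has derivative exp(- k u)
  h(w u) S(u); it tends to 0 at infinity.\<close>

lemma feynman_kac_eq:
  assumes k: "0 < k" and w: "continuous_on UNIV w" and h: "continuous_on UNIV h"
    and nonneg: "\<And>x. 0 \<le> h x"
  shows "feynman_kac k h w =
    1 - (\<integral>u. h (w u) * feynman_kac k h (\<lambda>s. w (u + s)) \<partial>exponential_law k) / k"
proof -
  let ?S = "\<lambda>u. feynman_kac k h (\<lambda>s. w (u + s))"
  note D = feynman_kac_has_derivative[OF k w h nonneg]
  have cont: "continuous_on UNIV ?S"
    using D by (auto intro!: continuous_at_imp_continuous_on DERIV_isCont)
  have "(\<integral>u. h (w u) * ?S u / k \<partial>exponential_law k) = 0 - - (exp (- (k * 0)) * (1 - ?S 0))"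
  proof (rule has_bochner_integral_integral_eq, rule exponential_integral_FTC[OF k, where F="\<lambda>u. - (exp (- (k * u)) * (1 - ?S u))"])
    show "(\<lambda>u. h (w u) * ?S u / k) \<in> borel_measurable borel"
      using k by (intro borel_measurable_continuous_onI continuous_intros cont
        continuous_on_compose2[OF h w]) auto
    show "0 \<le> h (w q) * ?S q / k" for q
      using k nonneg feynman_kac_bounds(1)[OF k nonneg] by simp
    show "((\<lambda>u. - (exp (- (k * u)) * (1 - ?S u))) has_real_derivative
        k * exp (- (k * q)) * (h (w q) * ?S q / k)) (at q)" for q
      using k by (auto intro!: derivative_eq_intros D simp: field_simps)
    have "((\<lambda>u. exp (- (k * u)) * (1 - ?S u)) \<longlongrightarrow> 0) at_top"
    proof (rule tendsto_sandwich)
      show "\<forall>\<^sub>F u in at_top. 0 \<le> exp (- (k * u)) * (1 - ?S u)"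
        using feynman_kac_bounds(2)[OF k nonneg] by simp
      show "\<forall>\<^sub>F u in at_top. exp (- (k * u)) * (1 - ?S u) \<le> exp (- (k * u))"
        using feynman_kac_bounds(1)[OF k nonneg] by simp
      show "((\<lambda>u. exp (- (k * u))) \<longlongrightarrow> 0) at_top"
        using k by real_asymp
    qed simp
    from tendsto_minus[OF this]
    show "((\<lambda>u. - (exp (- (k * u)) * (1 - ?S u))) \<longlongrightarrow> 0) at_top" by simp
  qed
  then show ?thesis by simp
qed

section \<open>The product of forward and backward survival probabilities\<close>

definition two_sided_kac :: "real \<Rightarrow> (real \<Rightarrow> real) \<Rightarrow> (real \<Rightarrow> real) \<Rightarrow> real" where
  "two_sided_kac k h w = feynman_kac k h w * feynman_kac k h (\<lambda>s. w (- s))"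

lemma two_sided_kac_bounds:
  assumes k: "0 < k" and nonneg: "\<And>x. 0 \<le> h x"
  shows "0 \<le> two_sided_kac k h w" and "two_sided_kac k h w \<le> 1"
  using feynman_kac_bounds[OF assms] by (auto simp: two_sided_kac_def mult_le_one)

text \<open>With \<open>V\<close> and \<open>V'\<close> the forward and backward factors seen from time \<open>u\<close>, the terms containing
  \<open>h\<close> cancel in the derivative of the product, leaving \<open>k (V - V')\<close>.\<close>

lemma two_sided_kac_lipschitz:
  assumes k: "0 < k" and w: "continuous_on UNIV w" and h: "continuous_on UNIV h"
    and nonneg: "\<And>x. 0 \<le> h x"
  shows "\<bar>two_sided_kac k h (\<lambda>s. w (u + s)) - two_sided_kac k h w\<bar> \<le> k * \<bar>u\<bar>"
proof -
  let ?V = "\<lambda>u. feynman_kac k h (\<lambda>s. w (u + s))" and ?V' = "\<lambda>u. feynman_kac k h (\<lambda>s. w (u - s))"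
  have w': "continuous_on UNIV (\<lambda>s. w (- s))"
    by (intro continuous_on_compose2[OF w] continuous_intros) auto
  have D: "(?V has_real_derivative (k + h (w x)) * ?V x - k) (at x)" for x
    by (rule feynman_kac_has_derivative[OF k w h nonneg])
  \<comment> \<open>Looking backward from \<open>x\<close> along \<open>w\<close> is looking forward
    from \<open>- x\<close> along the reflected path, so the derivative changes sign.\<close>
  have D': "(?V' has_real_derivative - ((k + h (w x)) * ?V' x - k)) (at x)" for x
    using DERIV_chain2[OF feynman_kac_has_derivative[OF k w' h nonneg, of "- x"] DERIV_minus[OF DERIV_ident]]
    by simp
  have B: "0 \<le> ?V x" "?V x \<le> 1" "0 \<le> ?V' x" "?V' x \<le> 1" for x
    using feynman_kac_bounds[OF k nonneg] by auto
  have "norm (?V u * ?V' u - ?V 0 * ?V' 0) \<le> k * norm (u - 0)"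
  proof (rule field_differentiable_bound[where S=UNIV])
    fix x
    show "((\<lambda>x. ?V x * ?V' x) has_real_derivative k * (?V x - ?V' x)) (at x within UNIV)"
      by (rule DERIV_cong[OF DERIV_mult[OF D D']]) (simp add: algebra_simps)
    show "norm (k * (?V x - ?V' x)) \<le> k"
      using B[of x] k by (simp add: abs_mult abs_le_iff)
  qed auto
  then show ?thesis by (simp add: two_sided_kac_def)
qed

subsection \<open>An explicit potential\<close>

text \<open>Equals e times the resolvent of rate e^2 applied to the standard normal density:
  Brownian motion run for time \<open>u\<close> raises the variance to 1 + u. The resolvent carries
  a factor 1 / e^2, so 1 / e remains.\<close>

definition resolvent_density :: "real \<Rightarrow> real \<Rightarrow> real" where
  "resolvent_density e x = (\<integral>u. normal_density 0 (sqrt (1 + u)) x \<partial>exponential_law (e\<^sup>2)) / e"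

text \<open>The potential is chosen backwards: for any nonnegative \<open>\<rho>\<close> with resolvent \<open>g = R\<rho>\<close>, the
  function \<open>v = 1 - g\<close> solves the Feynman--Kac equation \<open>v = 1 - R(h v)\<close> with \<open>h = \<rho> / v\<close>. Taking
  \<open>\<rho>\<close> to be the normal density scaled by \<open>e / 16\<close> makes \<open>g\<close> explicit and bounded, with
  \<open>g(0) - g(x)\<close> of order \<open>e\<close> for fixed \<open>x \<noteq> 0\<close>.\<close>

definition kac_mean :: "real \<Rightarrow> real \<Rightarrow> real" where
  "kac_mean e x = 1 - resolvent_density e x / 16"

definition kac_potential :: "real \<Rightarrow> real \<Rightarrow> real" where
  "kac_potential e x = e / 16 * std_normal_density x / kac_mean e x"

section \<open>Estimates for the explicit mean and potential\<close>

lemma normal_density_le: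
  assumes "0 \<le> u"
  shows "normal_density 0 (sqrt (1 + u)) x \<le> 1 / (2 * sqrt (1 + u))"
proof -
  have "2 \<le> sqrt (2 * pi)" using pi_gt3 by (intro real_le_rsqrt) auto
  then have "2 * sqrt (1 + u) \<le> sqrt (2 * pi * (1 + u))"
    using assms by (simp add: real_sqrt_mult mult_right_mono)
  then have "1 / sqrt (2 * pi * (1 + u)) \<le> 1 / (2 * sqrt (1 + u))"
    using assms by (intro divide_left_mono) auto
  moreover have "1 / sqrt (2 * pi * (1 + u)) * exp (- x\<^sup>2 / (2 * (1 + u))) \<le> 1 / sqrt (2 * pi * (1 + u)) * 1"
    using assms by (intro mult_left_mono) auto
  ultimately show ?thesis using assms by (simp add: normal_density_def)
qed

lemma normal_density_le_half:
  assumes "0 \<le> u"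
  shows "normal_density 0 (sqrt (1 + u)) x \<le> 1 / 2"
proof -
  have "1 / (2 * sqrt (1 + u)) \<le> 1 / 2" using assms by (intro divide_left_mono) auto
  with normal_density_le[OF assms] show ?thesis by (rule order_trans)
qed

lemma integrable_normal_density_time:
  assumes "0 < k"
  shows "integrable (exponential_law k) (\<lambda>u. normal_density 0 (sqrt (1 + u)) x)"
proof -
  interpret prob_space "exponential_law k" by (rule prob_space_exponential_density[OF assms])
  have "(\<lambda>u. normal_density 0 (sqrt (1 + u)) x) \<in> borel_measurable borel"
    unfolding normal_density_def by measurable
  moreover have "AE u in exponential_law k. norm (normal_density 0 (sqrt (1 + u)) x) \<le> 1 / 2"
    using AE_exponential_law_nonneg[of k]
  proof eventually_elim
    case (elim u)
    then show ?case using normal_density_le_half[of u x] by simp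
  qed
  ultimately show ?thesis by (intro integrable_const_bound[where B="1 / 2"]) simp_all
qed

lemma resolvent_density_nonneg: "0 < e \<Longrightarrow> 0 \<le> resolvent_density e x"
  by (auto simp: resolvent_density_def intro!: divide_nonneg_pos)

text \<open>The bound is uniform in \<open>e\<close>: the decay 1 / sqrt(1 + u), averaged over an
  exponential time of mean 1 / e^2, is of order \<open>e\<close>, which cancels the division by
  \<open>e\<close>.\<close>

lemma resolvent_density_le:
  assumes e: "0 < e" "e \<le> 1"
  shows "resolvent_density e x \<le> 4"
proof -
  define k where "k = e\<^sup>2"
  have k: "0 < k" "k \<le> 1" using e by (auto simp: k_def power_le_one)
  \<comment> \<open>A majorant of the normal density whose product with the exponential density is
    the derivative of 2 e arctan(e sqrt(1 + u)). That it is a majorant rests on 1 + k (1 + u) \<le>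
    2 exp(k u), where k \<le> 1 is used.\<close>
  define f where "f = (\<lambda>u. exp (k * u) / ((1 + k * (1 + u)) * sqrt (1 + u)))"
  have "has_bochner_integral (exponential_law k) f (2 * e * (pi / 2) - 2 * e * arctan (e * sqrt (1 + 0)))"
  proof (rule exponential_integral_FTC[OF k(1)])
    show "f \<in> borel_measurable borel" unfolding f_def by measurable
    show "0 \<le> f q" if "0 \<le> q" for q using that k by (simp add: f_def)
    show "((\<lambda>u. 2 * e * arctan (e * sqrt (1 + u))) has_real_derivative k * exp (- (k * q)) * f q) (at q)"
      if "0 \<le> q" for q
    proof -
      have "((\<lambda>u. 2 * e * arctan (e * sqrt (1 + u))) has_real_derivative
          2 * e * (inverse (1 + (e * sqrt (1 + q))\<^sup>2) * (e * (inverse (sqrt (1 + q)) / 2)))) (at q)"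
        using that by (auto intro!: derivative_eq_intros)
      moreover have "(e * sqrt (1 + q))\<^sup>2 = k * (1 + q)"
        using that by (simp add: k_def power_mult_distrib)
      moreover have "2 * e * (inverse (1 + k * (1 + q)) * (e * (inverse (sqrt (1 + q)) / 2)))
          = k * exp (- (k * q)) * f q"
        by (simp add: f_def k_def power2_eq_square exp_minus inverse_eq_divide)
      ultimately show ?thesis by simp
    qed
    have "filterlim (\<lambda>u. e * sqrt (1 + u)) at_top at_top" using e by real_asymp
    from filterlim_compose[OF tendsto_arctan_at_top this]
    show "((\<lambda>u. 2 * e * arctan (e * sqrt (1 + u))) \<longlongrightarrow> 2 * e * (pi / 2)) at_top"
      by (rule tendsto_mult_left)
  qed
  note f = integrable.intros[OF this] has_bochner_integral_integral_eq[OF this]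
  have "(\<integral>u. normal_density 0 (sqrt (1 + u)) x \<partial>exponential_law k) \<le> (\<integral>u. f u \<partial>exponential_law k)"
  proof (rule integral_mono_AE[OF integrable_normal_density_time[OF k(1)] f(1)])
    show "AE u in exponential_law k. normal_density 0 (sqrt (1 + u)) x \<le> f u"
      using AE_exponential_law_nonneg[of k]
    proof eventually_elim
      case (elim u)
      have ku: "0 \<le> k * u" using elim k by simp
      have "k * (1 + u) = k + k * u" by (simp add: algebra_simps)
      then have "1 + k * (1 + u) \<le> 2 * exp (k * u)" "0 < 1 + k * (1 + u)"
        using exp_ge_add_one_self[of "k * u"] ku k by linarith+
      then have "1 / 2 \<le> exp (k * u) / (1 + k * (1 + u))"
        by (simp add: le_divide_eq)
      then have "1 / 2 / sqrt (1 + u) \<le> exp (k * u) / (1 + k * (1 + u)) / sqrt (1 + u)"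
        using elim by (intro divide_right_mono) auto
      with normal_density_le[OF elim, of x] show ?case by (simp add: f_def)
    qed
  qed
  also have "\<dots> \<le> e * pi"
    using f(2) e by simp
  also have "\<dots> \<le> e * 4" using e pi_less_4 by simp
  finally show ?thesis using e by (simp add: resolvent_density_def k_def field_simps)
qed

lemma continuous_resolvent_density:
  assumes "0 < e"
  shows "continuous_on UNIV (resolvent_density e)"
proof -
  have k: "0 < e\<^sup>2" using assms by simp
  interpret prob_space "exponential_law (e\<^sup>2)" by (rule prob_space_exponential_density[OF k])
  have "(\<lambda>n. \<integral>u. normal_density 0 (sqrt (1 + u)) (X n) \<partial>exponential_law (e\<^sup>2))
      \<longlonglongrightarrow> (\<integral>u. normal_density 0 (sqrt (1 + u)) x \<partial>exponential_law (e\<^sup>2))"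
    if X: "X \<longlonglongrightarrow> x" for X x
  proof (rule integral_dominated_convergence[where w="\<lambda>_. 1 / 2"])
    show "AE u in exponential_law (e\<^sup>2). (\<lambda>n. normal_density 0 (sqrt (1 + u)) (X n))
        \<longlonglongrightarrow> normal_density 0 (sqrt (1 + u)) x"
      using AE_exponential_law_nonneg[of "e\<^sup>2"]
      by eventually_elim (auto simp: normal_density_def intro!: tendsto_intros X)
    show "AE u in exponential_law (e\<^sup>2). norm (normal_density 0 (sqrt (1 + u)) (X n)) \<le> 1 / 2" for n
      using AE_exponential_law_nonneg[of "e\<^sup>2"]
    proof eventually_elim
      case (elim u)
      then show ?case using normal_density_le_half[of u "X n"] by simp
    qed
  qed (use integrable_normal_density_time[OF k] in auto)
  then have "continuous_on UNIV (\<lambda>x. \<integral>u. normal_density 0 (sqrt (1 + u)) x \<partial>exponential_law (e\<^sup>2))"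
    by (auto simp: continuous_on_sequentially comp_def)
  then show ?thesis
    unfolding resolvent_density_def[abs_def] using assms by (intro continuous_intros) auto
qed

text \<open>The divisor 16 turns the resolvent bound 4 into 1/4. The lower bound 3/4 keeps the
  potential well defined and later yields the contraction factor (4/3) (1/4) = 1/3.\<close>

lemma kac_mean_bounds:
  assumes "0 < e" "e \<le> 1"
  shows "3 / 4 \<le> kac_mean e x" and "kac_mean e x \<le> 1"
  using resolvent_density_nonneg[of e x] resolvent_density_le[of e x] assms by (auto simp: kac_mean_def)

lemma continuous_kac_mean: "0 < e \<Longrightarrow> continuous_on UNIV (kac_mean e)"
  unfolding kac_mean_def[abs_def]
  by (intro continuous_intros continuous_resolvent_density) auto

lemma continuous_kac_potential:
  assumes "0 < e" "e \<le> 1"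
  shows "continuous_on UNIV (kac_potential e)"
  unfolding kac_potential_def[abs_def] std_normal_density_def
proof (intro continuous_intros continuous_kac_mean assms ballI)
  show "kac_mean e x \<noteq> 0" for x
    using kac_mean_bounds(1)[OF assms, of x] by auto
qed auto

lemma kac_potential_mult_mean:
  assumes "0 < e" "e \<le> 1"
  shows "kac_potential e x * kac_mean e x = e / 16 * std_normal_density x"
  using kac_mean_bounds(1)[OF assms, of x] by (auto simp: kac_potential_def)

lemma kac_potential_bounds:
  assumes "0 < e" "e \<le> 1"
  shows "0 \<le> kac_potential e x" and "kac_potential e x \<le> 1"
proof -
  note v = kac_mean_bounds(1)[OF assms, of x]
  show "0 \<le> kac_potential e x" using v assms by (simp add: kac_potential_def)
  have "kac_potential e x \<le> e / 16 * std_normal_density x / (3 / 4)"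
    unfolding kac_potential_def using v assms by (intro divide_left_mono) auto
  then have *: "kac_potential e x \<le> e / 12 * std_normal_density x" by simp
  have "e / 12 * std_normal_density x \<le> 1 * 1"
    using assms normal_density_le_half[of 0 x] by (intro mult_mono) auto
  with * show "kac_potential e x \<le> 1" by simp
qed

text \<open>For such \<open>u\<close> the variance 1 + u is at most 2, so the prefactor is at least
  1/4 and the exponential at \<open>x\<close> is at most exp(- x^2 / 4).\<close>

lemma normal_density_diff_ge:
  assumes "0 \<le> u" "u \<le> 1"
  shows "(1 - exp (- x\<^sup>2 / 4)) / 4 \<le> normal_density 0 (sqrt (1 + u)) 0 - normal_density 0 (sqrt (1 + u)) x"
proof -
  have "sqrt (2 * pi * (1 + u)) \<le> 4"
  proof (rule real_le_lsqrt)
    have "pi * (1 + u) \<le> 4 * 2" using assms pi_less_4 by (intro mult_mono) auto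
    then show "2 * pi * (1 + u) \<le> 4\<^sup>2" by simp
  qed (use assms in auto)
  then have "1 / 4 \<le> 1 / sqrt (2 * pi * (1 + u))"
    using assms by (intro divide_left_mono) auto
  moreover have "x\<^sup>2 / 4 \<le> x\<^sup>2 / (2 * (1 + u))"
    using assms by (intro divide_left_mono) auto
  then have "exp (- x\<^sup>2 / (2 * (1 + u))) \<le> exp (- x\<^sup>2 / 4)" by simp
  ultimately have "1 / 4 * (1 - exp (- x\<^sup>2 / 4)) \<le> 1 / sqrt (2 * pi * (1 + u)) * (1 - exp (- x\<^sup>2 / (2 * (1 + u))))"
    using assms by (intro mult_mono) auto
  also have "\<dots> = normal_density 0 (sqrt (1 + u)) 0 - normal_density 0 (sqrt (1 + u)) x"
    using assms by (simp add: normal_density_def right_diff_distrib)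
  finally show ?thesis by simp
qed

lemma normal_density_diff_nonneg:
  "normal_density 0 s x \<le> normal_density 0 s 0"
  by (simp add: normal_density_def divide_right_mono)

text \<open>Only clock values up to 1 are used. They have probability at least k / 2, and division
  by \<open>e\<close> leaves order \<open>e\<close>. The constant is 128 = 4 * 2 * 16, from the
  density gap, this probability and the divisor in \<open>kac_mean\<close>; the sum of the two means
  is at least 1.\<close>

lemma kac_mean_square_diff_ge:
  assumes e: "0 < e" "e \<le> 1"
  shows "e * ((1 - exp (- x\<^sup>2 / 4)) / 128) \<le> (kac_mean e x)\<^sup>2 - (kac_mean e 0)\<^sup>2"
proof -
  define k where "k = e\<^sup>2"
  have k: "0 < k" "k \<le> 1" using e by (auto simp: k_def power_le_one)
  define c where "c = (1 - exp (- x\<^sup>2 / 4)) / 4"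
  have c: "0 \<le> c" by (simp add: c_def)
  interpret prob_space "exponential_law k" by (rule prob_space_exponential_density[OF k(1)])
  let ?p = "\<lambda>x u. normal_density 0 (sqrt (1 + u)) x"
  have "k / 2 \<le> 1 - exp (- k)"
  proof -
    have "(1 - k / 2) * (1 + k) \<ge> 1" using k by (simp add: algebra_simps mult_left_le)
    moreover have "(1 - k / 2) * (1 + k) \<le> (1 - k / 2) * exp k"
      using k exp_ge_add_one_self[of k] by (intro mult_left_mono) auto
    ultimately have "1 \<le> (1 - k / 2) * exp k" by simp
    then show ?thesis by (simp add: exp_minus field_simps)
  qed
  moreover have "prob {..1} = 1 - exp (- k)"
    using k emeasure_erlang_density[of k 0 1]
    by (simp add: measure_def erlang_CDF_0)
  ultimately have "c * (k / 2) \<le> c * prob {..1}"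
    using c by (intro mult_left_mono) auto
  also have "\<dots> = (\<integral>u. c * indicator {..1} u \<partial>exponential_law k)" by simp
  also have "\<dots> \<le> (\<integral>u. ?p 0 u - ?p x u \<partial>exponential_law k)"
  proof (rule integral_mono_AE)
    show "AE u in exponential_law k. c * indicator {..1} u \<le> ?p 0 u - ?p x u"
      using AE_exponential_law_nonneg[of k]
    proof eventually_elim
      case (elim u)
      then show ?case
        using normal_density_diff_ge[of u x] normal_density_diff_nonneg[of "sqrt (1 + u)" x]
        by (cases "u \<le> 1") (auto simp: c_def)
    qed
    show "integrable (exponential_law k) (\<lambda>u. ?p 0 u - ?p x u)"
      by (intro Bochner_Integration.integrable_diff integrable_normal_density_time[OF k(1)])
    have "integrable (exponential_law k) (indicator {..1} :: real \<Rightarrow> real)"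
      by (intro integrable_real_indicator) (auto simp: emeasure_eq_measure)
    then show "integrable (exponential_law k) (\<lambda>u. c * indicator {..1} u)"
      by (intro integrable_mult_right)
  qed
  also have "\<dots> = e * (resolvent_density e 0 - resolvent_density e x)"
    using e integrable_normal_density_time[OF k(1)]
    by (simp add: resolvent_density_def k_def right_diff_distrib)
  finally have "e * (c * e / 2) \<le> e * (resolvent_density e 0 - resolvent_density e x)"
    by (simp add: k_def power2_eq_square mult_ac)
  then have "c * e / 2 \<le> resolvent_density e 0 - resolvent_density e x" using e by simp
  then have d: "c * e / 32 \<le> kac_mean e x - kac_mean e 0" by (simp add: kac_mean_def)
  have "0 \<le> c * e / 32" using c e by simp
  moreover have "1 \<le> kac_mean e x + kac_mean e 0"
    using kac_mean_bounds(1)[OF e, of x] kac_mean_bounds(1)[OF e, of 0] by linarith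
  ultimately have "c * e / 32 * 1 \<le> (kac_mean e x - kac_mean e 0) * (kac_mean e x + kac_mean e 0)"
    using d by (intro mult_mono) linarith+
  then show ?thesis by (simp add: c_def power2_eq_square algebra_simps)
qed

text \<open>Variances add under convolution of centred normal laws. The increment law is given for
  strictly ordered times, hence \<open>0 < u\<close>.\<close>

lemma continuous_BM_normal_convolution:
  assumes X: "continuous_BM M X" and u: "0 < u"
  shows "(\<integral>\<omega>. std_normal_density (x + X u \<omega>) \<partial>M) = normal_density 0 (sqrt (1 + u)) x"
proof -
  interpret prob_space M by (rule continuous_BMD(1)[OF X])
  note [measurable] = continuous_BMD(2)[OF X]
  have D: "distributed M lborel (\<lambda>\<omega>. X u \<omega> - X 0 \<omega>) (normal_density 0 (sqrt u))"
    using continuous_BMD(5)[OF X u] by simp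
  have "(\<integral>\<omega>. std_normal_density (x + X u \<omega>) \<partial>M) = (\<integral>\<omega>. std_normal_density (x + (X u \<omega> - X 0 \<omega>)) \<partial>M)"
    using continuous_BMD(3)[OF X] by (intro integral_cong_AE) auto
  also have "\<dots> = (\<integral>z. normal_density 0 (sqrt u) z * std_normal_density (x + z) \<partial>lborel)"
    using distributed_integral[OF D, of "\<lambda>z. std_normal_density (x + z)"] by simp
  \<comment> \<open>By symmetry of the normal density this is the convolution evaluated at
    \<open>- x\<close>.\<close>
  also have "\<dots> = (\<integral>z. normal_density 0 1 (- x - z) * normal_density 0 (sqrt u) z \<partial>lborel)"
    by (intro Bochner_Integration.integral_cong) (auto simp: normal_density_def power2_commute power2_eq_square algebra_simps)
  also have "\<dots> = enn2real (\<integral>\<^sup>+z. ennreal (normal_density 0 1 (- x - z) * normal_density 0 (sqrt u) z) \<partial>lborel)"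
    by (rule integral_eq_nn_integral) auto
  also have "\<dots> = normal_density 0 (sqrt (1 + u)) x"
    using fun_cong[OF conv_normal_density_zero_mean[of 1 "sqrt u"], of "- x"] u
    by (simp add: normal_density_def)
  finally show ?thesis .
qed

text \<open>The potential times the mean is the scaled normal density by construction, so the
  equation v = 1 - R(h v) reduces to the definition of \<open>kac_mean\<close>.\<close>

lemma kac_mean_eq:
  assumes e: "0 < e" "e \<le> 1" and X: "continuous_BM M X"
  shows "kac_mean e x =
    1 - (\<integral>u. (\<integral>\<omega>. kac_potential e (x + X u \<omega>) * kac_mean e (x + X u \<omega>) \<partial>M) \<partial>exponential_law (e\<^sup>2)) / e\<^sup>2"
proof -
  interpret prob_space M by (rule continuous_BMD(1)[OF X])
  have [measurable]: "(\<lambda>p. X (fst p) (snd p)) \<in> borel_measurable (borel \<Otimes>\<^sub>M M)"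
    by (rule continuous_BM_measurable_pair[OF X])
  have eq: "kac_potential e y * kac_mean e y = e / 16 * std_normal_density y" for y
    by (rule kac_potential_mult_mean[OF e])
  have "AE u in lborel. u \<noteq> (0::real)" by (rule AE_lborel_singleton)
  then have pos: "AE u in exponential_law (e\<^sup>2). 0 < u"
    by (auto simp: AE_density erlang_density_def elim!: eventually_mono)
  have "(\<integral>u. (\<integral>\<omega>. kac_potential e (x + X u \<omega>) * kac_mean e (x + X u \<omega>) \<partial>M) \<partial>exponential_law (e\<^sup>2))
      = (\<integral>u. e / 16 * normal_density 0 (sqrt (1 + u)) x \<partial>exponential_law (e\<^sup>2))"
  proof (rule integral_cong_AE)
    have "(\<lambda>u. \<integral>\<omega>. e / 16 * std_normal_density (x + X u \<omega>) \<partial>M) \<in> borel_measurable borel"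
      by (rule borel_measurable_lebesgue_integral) (simp add: split_beta')
    then show "(\<lambda>u. \<integral>\<omega>. kac_potential e (x + X u \<omega>) * kac_mean e (x + X u \<omega>) \<partial>M)
        \<in> borel_measurable (exponential_law (e\<^sup>2))"
      unfolding eq by simp
    have "(\<lambda>u. e / 16 * normal_density 0 (sqrt (1 + u)) x) \<in> borel_measurable borel"
      unfolding normal_density_def by measurable
    then show "(\<lambda>u. e / 16 * normal_density 0 (sqrt (1 + u)) x) \<in> borel_measurable (exponential_law (e\<^sup>2))"
      by simp
    show "AE u in exponential_law (e\<^sup>2).
        (\<integral>\<omega>. kac_potential e (x + X u \<omega>) * kac_mean e (x + X u \<omega>) \<partial>M)
          = e / 16 * normal_density 0 (sqrt (1 + u)) x"
      using pos by eventually_elim (simp add: eq continuous_BM_normal_convolution[OF X])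
  qed
  moreover have "kac_mean e x =
      1 - (\<integral>u. e / 16 * normal_density 0 (sqrt (1 + u)) x \<partial>exponential_law (e\<^sup>2)) / e\<^sup>2"
    unfolding kac_mean_def resolvent_density_def using e by (simp add: power2_eq_square)
  ultimately show ?thesis by (simp only:)
qed

subsection \<open>Expectations under Brownian motion\<close>

text \<open>Paths that are frozen before time 0 can thus be exchanged for the original ones.\<close>

lemma feynman_kac_cong:
  assumes "\<And>s. 0 \<le> s \<Longrightarrow> w s = w' s"
  shows "feynman_kac k h w = feynman_kac k h w'"
  unfolding feynman_kac_def using assms
  by (auto intro!: Bochner_Integration.integral_cong set_lebesgue_integral_cong)

lemma measurable_feynman_kac:
  assumes k: "0 < k" and h: "h \<in> borel_measurable borel" and f: "f \<in> N \<rightarrow>\<^sub>M path_space"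
  shows "(\<lambda>x. feynman_kac k h (f x)) \<in> borel_measurable N"
proof -
  interpret prob_space "exponential_law k" by (rule prob_space_exponential_density[OF k])
  have f': "(\<lambda>p. f (fst (fst p))) \<in> (N \<Otimes>\<^sub>M exponential_law k) \<Otimes>\<^sub>M lborel \<rightarrow>\<^sub>M path_space"
    by (rule measurable_compose[OF _ f]) simp
  have "(\<lambda>p. f (fst (fst p)) (snd p)) \<in> borel_measurable ((N \<Otimes>\<^sub>M exponential_law k) \<Otimes>\<^sub>M lborel)"
    by (rule measurable_path_eval'[OF f']) simp
  from measurable_compose[OF this h]
  have hf: "(\<lambda>p. h (f (fst (fst p)) (snd p))) \<in> borel_measurable ((N \<Otimes>\<^sub>M exponential_law k) \<Otimes>\<^sub>M lborel)" .
  have q: "(\<lambda>p. snd (fst p)) \<in> borel_measurable ((N \<Otimes>\<^sub>M exponential_law k) \<Otimes>\<^sub>M lborel)"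
    using measurable_compose[OF measurable_fst measurable_snd, of N "exponential_law k" lborel] by simp
  have r: "snd \<in> borel_measurable ((N \<Otimes>\<^sub>M exponential_law k) \<Otimes>\<^sub>M lborel)"
    using measurable_snd[of "N \<Otimes>\<^sub>M exponential_law k" lborel] by simp
  \<comment> \<open>The range of integration depends on \<open>q\<close>, so it is moved into the
    integrand as a cutoff that is jointly measurable in path, \<open>q\<close> and
    \<open>r\<close>.\<close>
  have "(\<lambda>p. if 0 \<le> snd p \<and> snd p \<le> snd (fst p) then h (f (fst (fst p)) (snd p)) else 0)
      \<in> borel_measurable ((N \<Otimes>\<^sub>M exponential_law k) \<Otimes>\<^sub>M lborel)"
    by (intro measurable_If[OF hf] sets.sets_Collect_conj borel_measurable_le q r borel_measurable_const)
  moreover have "(\<lambda>p. if 0 \<le> snd p \<and> snd p \<le> snd (fst p) then h (f (fst (fst p)) (snd p)) else 0) =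
      case_prod (\<lambda>p r. indicator {0..snd p} r *\<^sub>R h (f (fst p) r))"
    by (auto simp: fun_eq_iff)
  ultimately have "(\<lambda>p. LINT r:{0..snd p}|lborel. h (f (fst p) r)) \<in> borel_measurable (N \<Otimes>\<^sub>M exponential_law k)"
    unfolding set_lebesgue_integral_def
    by (intro lborel.borel_measurable_lebesgue_integral) simp
  then have "(\<lambda>p. exp (- (LINT r:{0..snd p}|lborel. h (f (fst p) r)))) \<in> borel_measurable (N \<Otimes>\<^sub>M exponential_law k)"
    by simp
  moreover have "(\<lambda>p. exp (- (LINT r:{0..snd p}|lborel. h (f (fst p) r)))) =
      case_prod (\<lambda>x q. exp (- (LINT r:{0..q}|lborel. h (f x r))))"
    by (simp add: split_beta')
  ultimately show ?thesis
    unfolding feynman_kac_def by (intro borel_measurable_lebesgue_integral) simp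
qed

lemma exponential_law_Fubini:
  fixes f :: "'a \<Rightarrow> real \<Rightarrow> real"
  assumes M: "prob_space M" and k: "0 < k"
    and f: "(\<lambda>p. f (snd p) (fst p)) \<in> borel_measurable (borel \<Otimes>\<^sub>M M)"
    and bound: "\<And>\<omega> u. \<omega> \<in> space M \<Longrightarrow> \<bar>f \<omega> u\<bar> \<le> B"
  shows "(\<integral>\<omega>. (\<integral>u. f \<omega> u \<partial>exponential_law k) \<partial>M) = (\<integral>u. (\<integral>\<omega>. f \<omega> u \<partial>M) \<partial>exponential_law k)"
    and "integrable (exponential_law k) (\<lambda>u. \<integral>\<omega>. f \<omega> u \<partial>M)"
    and "integrable M (\<lambda>\<omega>. \<integral>u. f \<omega> u \<partial>exponential_law k)"
proof -
  interpret M: prob_space M by (rule M)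
  interpret Q: prob_space "exponential_law k" by (rule prob_space_exponential_density[OF k])
  interpret P: pair_prob_space "exponential_law k" M ..
  have "sets (exponential_law k \<Otimes>\<^sub>M M) = sets (borel \<Otimes>\<^sub>M M)"
    by (rule sets_pair_measure_cong) auto
  then have m: "case_prod (\<lambda>u \<omega>. f \<omega> u) \<in> borel_measurable (exponential_law k \<Otimes>\<^sub>M M)"
    by (subst measurable_cong_sets[OF _ refl]) (use f in \<open>simp_all add: split_beta'\<close>)
  have "AE p in exponential_law k \<Otimes>\<^sub>M M. norm (case_prod (\<lambda>u \<omega>. f \<omega> u) p) \<le> B"
    by (rule AE_I2) (auto simp: space_pair_measure intro: bound)
  from P.integrable_const_bound[OF this m]
  have int: "integrable (exponential_law k \<Otimes>\<^sub>M M) (case_prod (\<lambda>u \<omega>. f \<omega> u))" .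
  show "(\<integral>\<omega>. (\<integral>u. f \<omega> u \<partial>exponential_law k) \<partial>M) = (\<integral>u. (\<integral>\<omega>. f \<omega> u \<partial>M) \<partial>exponential_law k)"
    by (rule P.Fubini_integral[OF int])
  show "integrable (exponential_law k) (\<lambda>u. \<integral>\<omega>. f \<omega> u \<partial>M)"
    by (rule P.integrable_fst[OF int])
  show "integrable M (\<lambda>\<omega>. \<integral>u. f \<omega> u \<partial>exponential_law k)"
    by (rule P.integrable_snd[OF int])
qed

lemma continuous_BM_translate_path:
  assumes X: "continuous_BM M X"
  shows "(\<lambda>p s. x + X (fst p + s) (snd p)) \<in> borel \<Otimes>\<^sub>M M \<rightarrow>\<^sub>M path_space"
proof (rule measurable_path_spaceI)
  fix s
  have "(\<lambda>p. (fst p + s, snd p)) \<in> borel \<Otimes>\<^sub>M M \<rightarrow>\<^sub>M (borel :: real measure) \<Otimes>\<^sub>M M"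
    by (intro measurable_Pair borel_measurable_add measurable_fst measurable_snd borel_measurable_const)
  from measurable_compose[OF this continuous_BM_measurable_pair[OF X]]
  have "(\<lambda>p. X (fst p + s) (snd p)) \<in> borel_measurable (borel \<Otimes>\<^sub>M M)"
    by (simp only: fst_conv snd_conv)
  then show "(\<lambda>p. x + X (fst p + s) (snd p)) \<in> borel_measurable (borel \<Otimes>\<^sub>M M)"
    by (intro borel_measurable_add borel_measurable_const)
next
  fix p :: "real \<times> 'a" assume "p \<in> space (borel \<Otimes>\<^sub>M M)"
  then have "snd p \<in> space M" by (auto simp: space_pair_measure)
  from continuous_on_compose2[OF continuous_BMD(4)[OF X this], of UNIV "\<lambda>s. fst p + s"]
  have "continuous_on UNIV (\<lambda>s. X (fst p + s) (snd p))"
    by (simp add: continuous_on_add continuous_on_id continuous_on_const)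
  then show "continuous_on UNIV (\<lambda>s. x + X (fst p + s) (snd p))"
    by (intro continuous_on_add continuous_on_const)
qed

lemma continuous_BM_path_translate:
  assumes X: "continuous_BM M X"
  shows "(\<lambda>\<omega> s. x + X (r + s) \<omega>) \<in> M \<rightarrow>\<^sub>M path_space"
proof -
  have "(\<lambda>\<omega>. (r, \<omega>)) \<in> M \<rightarrow>\<^sub>M borel \<Otimes>\<^sub>M M" by (rule measurable_Pair1') simp
  from measurable_compose[OF this continuous_BM_translate_path[OF X, of x]]
  show ?thesis by (simp only: fst_conv snd_conv)
qed

lemma measurable_feynman_kac_translate_mean:
  assumes X: "continuous_BM M X" and k: "0 < k" and h: "h \<in> borel_measurable borel"
  shows "(\<lambda>y. \<integral>\<omega>. feynman_kac k h (\<lambda>s. y + X s \<omega>) \<partial>M) \<in> borel_measurable borel"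
proof -
  interpret prob_space M by (rule continuous_BMD(1)[OF X])
  have "(\<lambda>p s. fst p + X s (snd p)) \<in> (borel :: real measure) \<Otimes>\<^sub>M M \<rightarrow>\<^sub>M path_space"
  proof (rule measurable_path_spaceI)
    show "(\<lambda>p. fst p + X s (snd p)) \<in> borel_measurable (borel \<Otimes>\<^sub>M M)" for s
      by (intro borel_measurable_add measurable_compose[OF measurable_snd continuous_BMD(2)[OF X]]) simp
    show "continuous_on UNIV (\<lambda>s. fst p + X s (snd p))" if "p \<in> space (borel \<Otimes>\<^sub>M M)" for p
      using that continuous_BMD(4)[OF X] by (intro continuous_intros) (auto simp: space_pair_measure)
  qed
  from measurable_feynman_kac[OF k h this]
  show ?thesis by (intro borel_measurable_lebesgue_integral) (simp add: split_beta')
qed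

text \<open>The past of the increments after time \<open>u\<close> contains \<open>X u\<close>, up to the null set on which
  \<open>X 0 \<noteq> 0\<close>; so the independence of past and future of the shifted process is the Markov property.\<close>

lemma continuous_BM_Markov:
  assumes X: "continuous_BM M X" and u: "0 \<le> u" and k: "0 < k"
    and h: "continuous_on UNIV h" and h_bounds: "\<And>x. 0 \<le> h x" "\<And>x. h x \<le> b"
  shows "(\<integral>\<omega>. h (x + X u \<omega>) * feynman_kac k h (\<lambda>s. x + X (u + s) \<omega>) \<partial>M) =
    (\<integral>\<omega>. h (x + X u \<omega>) *
      (\<integral>\<omega>'. feynman_kac k h (\<lambda>s. (x + X u \<omega>) + (X (u + s) \<omega>' - X u \<omega>')) \<partial>M) \<partial>M)"
proof -
  interpret prob_space M by (rule continuous_BMD(1)[OF X])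
  let ?X' = "\<lambda>t \<omega>. X (u + t) \<omega> - X u \<omega>"
  let ?F = "\<lambda>\<omega> s. ?X' (max s 0) \<omega> - ?X' 0 \<omega>" and ?P = "\<lambda>\<omega> s. ?X' (- max s 0) \<omega> - ?X' 0 \<omega>"
  let ?G = "\<lambda>p. h (x - snd p u) * feynman_kac k h (\<lambda>s. (x - snd p u) + fst p s)"
  have X': "continuous_BM M ?X'" by (rule continuous_BM_shift[OF X])
  have hm: "h \<in> borel_measurable borel" using h by (rule borel_measurable_continuous_onI)
  have F: "?F \<in> M \<rightarrow>\<^sub>M path_space"
    by (rule continuous_BM_path[OF X']) (intro continuous_intros)
  have P: "?P \<in> M \<rightarrow>\<^sub>M path_space"
    by (rule continuous_BM_path[OF X']) (intro continuous_intros)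
  have fst_path: "(\<lambda>p. fst p) \<in> path_space \<Otimes>\<^sub>M path_space \<rightarrow>\<^sub>M path_space" by simp
  have x_u: "(\<lambda>p. x - snd p u) \<in> borel_measurable (path_space \<Otimes>\<^sub>M path_space)"
    by (intro borel_measurable_diff borel_measurable_const
        measurable_compose[OF measurable_snd measurable_path_coord])
  have path: "(\<lambda>p s. (x - snd p u) + fst p s) \<in> path_space \<Otimes>\<^sub>M path_space \<rightarrow>\<^sub>M path_space"
  proof (rule measurable_path_spaceI)
    show "(\<lambda>p. (x - snd p u) + fst p s) \<in> borel_measurable (path_space \<Otimes>\<^sub>M path_space)" for s
      by (intro borel_measurable_add x_u measurable_compose[OF measurable_fst measurable_path_coord])
    show "continuous_on UNIV (\<lambda>s. (x - snd p u) + fst p s)"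
      if "p \<in> space (path_space \<Otimes>\<^sub>M path_space)" for p
      using continuous_path[OF fst_path that] by (intro continuous_intros)
  qed
  have G: "?G \<in> borel_measurable (path_space \<Otimes>\<^sub>M path_space)"
    by (intro borel_measurable_times measurable_compose[OF x_u hm] measurable_feynman_kac[OF k hm path])
  have "\<bar>?G p\<bar> \<le> b" for p
    using feynman_kac_bounds[OF k h_bounds(1)] h_bounds mult_mono[of "h (x - snd p u)" b _ 1]
    by (simp add: abs_mult order_trans[OF h_bounds(1) h_bounds(2)])
  with indep_set_expectation[OF F P continuous_BM_indep_past_future[OF X'] G, of b]
  have *: "(\<integral>\<omega>. ?G (?F \<omega>, ?P \<omega>) \<partial>M) = (\<integral>\<omega>. (\<integral>\<omega>'. ?G (?F \<omega>', ?P \<omega>) \<partial>M) \<partial>M)"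
    by blast
  \<comment> \<open>Evaluating the past path at \<open>u\<close> undoes the shift:
    \<open>?P \<omega> u\<close> is \<open>X 0 \<omega> - X u \<omega>\<close>, which is almost
    surely \<open>- X u \<omega>\<close>.\<close>
  have P_u: "AE \<omega> in M. x - ?P \<omega> u = x + X u \<omega>"
    using continuous_BMD(3)[OF X] by eventually_elim (use u in simp)
  have F_eq: "feynman_kac k h (\<lambda>s. y + ?F \<omega> s) = feynman_kac k h (\<lambda>s. y + ?X' s \<omega>)" for y \<omega>
    by (rule feynman_kac_cong) simp
  have "(\<integral>\<omega>. h (x + X u \<omega>) * feynman_kac k h (\<lambda>s. x + X (u + s) \<omega>) \<partial>M) = (\<integral>\<omega>. ?G (?F \<omega>, ?P \<omega>) \<partial>M)"
  proof (rule integral_cong_AE)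
    show "(\<lambda>\<omega>. ?G (?F \<omega>, ?P \<omega>)) \<in> borel_measurable M"
      by (rule measurable_compose[OF measurable_Pair[OF F P] G])
    have "(\<lambda>\<omega>. x + X u \<omega>) \<in> borel_measurable M" using continuous_BMD(2)[OF X] by simp
    then show "(\<lambda>\<omega>. h (x + X u \<omega>) * feynman_kac k h (\<lambda>s. x + X (u + s) \<omega>)) \<in> borel_measurable M"
      by (intro borel_measurable_times measurable_compose[OF _ hm]
          measurable_feynman_kac[OF k hm continuous_BM_path_translate[OF X]])
    show "AE \<omega> in M. h (x + X u \<omega>) * feynman_kac k h (\<lambda>s. x + X (u + s) \<omega>) = ?G (?F \<omega>, ?P \<omega>)"
      using P_u
    proof eventually_elim
      case (elim \<omega>)
      have "?G (?F \<omega>, ?P \<omega>) = h (x - ?P \<omega> u) * feynman_kac k h (\<lambda>s. (x - ?P \<omega> u) + ?F \<omega> s)"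
        by (simp only: fst_conv snd_conv)
      also have "\<dots> = h (x + X u \<omega>) * feynman_kac k h (\<lambda>s. (x + X u \<omega>) + ?X' s \<omega>)"
        unfolding elim F_eq ..
      finally show ?case by simp
    qed
  qed
  also note *
  also have "(\<integral>\<omega>. (\<integral>\<omega>'. ?G (?F \<omega>', ?P \<omega>) \<partial>M) \<partial>M) =
      (\<integral>\<omega>. h (x + X u \<omega>) * (\<integral>\<omega>'. feynman_kac k h (\<lambda>s. (x + X u \<omega>) + ?X' s \<omega>') \<partial>M) \<partial>M)"
  proof (rule integral_cong_AE)
    let ?V = "\<lambda>y. \<integral>\<omega>'. feynman_kac k h (\<lambda>s. y + ?X' s \<omega>') \<partial>M"
    have V: "(\<lambda>y. h y * ?V y) \<in> borel_measurable borel"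
      by (intro borel_measurable_times hm measurable_feynman_kac_translate_mean[OF X' k hm])
    have eq: "(\<integral>\<omega>'. ?G (?F \<omega>', ?P \<omega>) \<partial>M) = h (x - ?P \<omega> u) * ?V (x - ?P \<omega> u)" for \<omega>
    proof -
      have "(\<integral>\<omega>'. ?G (?F \<omega>', ?P \<omega>) \<partial>M) =
          (\<integral>\<omega>'. h (x - ?P \<omega> u) * feynman_kac k h (\<lambda>s. (x - ?P \<omega> u) + ?F \<omega>' s) \<partial>M)"
        by (simp only: fst_conv snd_conv)
      also have "\<dots> = h (x - ?P \<omega> u) * ?V (x - ?P \<omega> u)"
        unfolding F_eq by (rule integral_mult_right_zero)
      finally show ?thesis .
    qed
    have "(\<lambda>\<omega>. x - ?P \<omega> u) \<in> borel_measurable M" "(\<lambda>\<omega>. x + X u \<omega>) \<in> borel_measurable M"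
      using continuous_BMD(2)[OF X] by simp_all
    note m = measurable_compose[OF this(1) V] measurable_compose[OF this(2) V]
    show "(\<lambda>\<omega>. \<integral>\<omega>'. ?G (?F \<omega>', ?P \<omega>) \<partial>M) \<in> borel_measurable M"
      unfolding eq by (rule m(1))
    show "(\<lambda>\<omega>. h (x + X u \<omega>) * ?V (x + X u \<omega>)) \<in> borel_measurable M" by (rule m(2))
    show "AE \<omega> in M. (\<integral>\<omega>'. ?G (?F \<omega>', ?P \<omega>) \<partial>M) = h (x + X u \<omega>) * ?V (x + X u \<omega>)"
      using P_u unfolding eq by eventually_elim (simp only:)
  qed
  finally show ?thesis .
qed

text \<open>The resolvent weighted by \<open>h\<close> is a contraction with factor \<open>\<theta>\<close>. The estimate is iterated
  over the shifts of \<open>X\<close>, so neither uniqueness of the Brownian law nor of \<open>v\<close> has to be known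
  beforehand.\<close>

lemma feynman_kac_expectation_step:
  assumes X: "continuous_BM M X" and k: "0 < k"
    and h: "continuous_on UNIV h" and h_bounds: "\<And>x. 0 \<le> h x" "\<And>x. h x \<le> b"
    and v: "continuous_on UNIV v" and v_bounds: "\<And>x. 0 \<le> v x" "\<And>x. v x \<le> 1"
    and eq: "v x = 1 - (\<integral>u. (\<integral>\<omega>. h (x + X u \<omega>) * v (x + X u \<omega>) \<partial>M) \<partial>exponential_law k) / k"
    and small: "(\<integral>u. (\<integral>\<omega>. h (x + X u \<omega>) \<partial>M) \<partial>exponential_law k) \<le> k * \<theta>"
    and c: "0 \<le> c" and close: "\<And>u y. 0 \<le> u \<Longrightarrow>
      \<bar>(\<integral>\<omega>. feynman_kac k h (\<lambda>s. y + (X (u + s) \<omega> - X u \<omega>)) \<partial>M) - v y\<bar> \<le> c"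
  shows "\<bar>(\<integral>\<omega>. feynman_kac k h (\<lambda>s. x + X s \<omega>) \<partial>M) - v x\<bar> \<le> \<theta> * c"
proof -
  have M: "prob_space M" by (rule continuous_BMD(1)[OF X])
  interpret prob_space M by (rule M)
  interpret Q: prob_space "exponential_law k" by (rule prob_space_exponential_density[OF k])
  have hm: "h \<in> borel_measurable borel" and vm: "v \<in> borel_measurable borel"
    using h v by (auto intro: borel_measurable_continuous_onI)
  have b: "0 \<le> b" using h_bounds[of 0] by linarith
  let ?f = "\<lambda>\<omega> u. h (x + X u \<omega>) * feynman_kac k h (\<lambda>s. x + X (u + s) \<omega>)"
  let ?g = "\<lambda>\<omega> u. h (x + X u \<omega>) * v (x + X u \<omega>)"
  let ?h = "\<lambda>\<omega> u. h (x + X u \<omega>)"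
  have pair: "(\<lambda>p. x + X (fst p) (snd p)) \<in> borel_measurable (borel \<Otimes>\<^sub>M M)"
    by (intro borel_measurable_add borel_measurable_const continuous_BM_measurable_pair[OF X])
  note h_pair = measurable_compose[OF pair hm]
  have f_pair: "(\<lambda>p. ?f (snd p) (fst p)) \<in> borel_measurable (borel \<Otimes>\<^sub>M M)"
    by (intro borel_measurable_times h_pair
        measurable_feynman_kac[OF k hm continuous_BM_translate_path[OF X]])
  have g_pair: "(\<lambda>p. ?g (snd p) (fst p)) \<in> borel_measurable (borel \<Otimes>\<^sub>M M)"
    by (intro borel_measurable_times h_pair measurable_compose[OF pair vm])
  have V: "0 \<le> feynman_kac k h w" "feynman_kac k h w \<le> 1" for w
    by (rule feynman_kac_bounds[OF k h_bounds(1)])+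
  have f_bound: "\<bar>?f \<omega> u\<bar> \<le> b" for \<omega> u
    using mult_mono[OF h_bounds(2) V(2) b V(1)] h_bounds(1) V(1) by (simp add: abs_mult)
  have g_bound: "\<bar>?g \<omega> u\<bar> \<le> b" for \<omega> u
    using mult_mono[OF h_bounds(2) v_bounds(2) b v_bounds(1)] h_bounds(1) v_bounds(1)
    by (simp add: abs_mult)
  have h_bound: "\<bar>?h \<omega> u\<bar> \<le> b" for \<omega> u using h_bounds by simp
  note f = exponential_law_Fubini[where f="?f", OF M k f_pair f_bound]
  note g = exponential_law_Fubini[where f="?g", OF M k g_pair g_bound]
  note h' = exponential_law_Fubini[where f="?h", OF M k h_pair h_bound]
  have "(\<integral>\<omega>. feynman_kac k h (\<lambda>s. x + X s \<omega>) \<partial>M) =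
      (\<integral>\<omega>. 1 - (\<integral>u. ?f \<omega> u \<partial>exponential_law k) / k \<partial>M)"
  proof (rule Bochner_Integration.integral_cong[OF refl])
    fix \<omega> assume \<omega>: "\<omega> \<in> space M"
    have "continuous_on UNIV (\<lambda>s. x + X s \<omega>)"
      by (intro continuous_on_add continuous_on_const continuous_BMD(4)[OF X \<omega>])
    from feynman_kac_eq[OF k this h h_bounds(1)]
    show "feynman_kac k h (\<lambda>s. x + X s \<omega>) = 1 - (\<integral>u. ?f \<omega> u \<partial>exponential_law k) / k" .
  qed
  also have "\<dots> = (\<integral>\<omega>. 1 \<partial>M) - (\<integral>\<omega>. (\<integral>u. ?f \<omega> u \<partial>exponential_law k) / k \<partial>M)"
    by (rule Bochner_Integration.integral_diff[OF integrable_const integrable_divide_zero[OF f(3)]])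
  also have "\<dots> = 1 - (\<integral>\<omega>. (\<integral>u. ?f \<omega> u \<partial>exponential_law k) \<partial>M) / k"
    by (simp only: lebesgue_integral_const prob_space scaleR_one integral_divide_zero)
  also have "\<dots> = 1 - (\<integral>u. (\<integral>\<omega>. ?f \<omega> u \<partial>M) \<partial>exponential_law k) / k"
    unfolding f(1) ..
  finally have mean: "(\<integral>\<omega>. feynman_kac k h (\<lambda>s. x + X s \<omega>) \<partial>M) =
      1 - (\<integral>u. (\<integral>\<omega>. ?f \<omega> u \<partial>M) \<partial>exponential_law k) / k" .
  \<comment> \<open>By the Markov property the functional may be replaced by its mean from the point
    \<open>x + X u\<close>, and \<open>close\<close> compares that mean with \<open>v\<close> at the
    same point. The error keeps the weight \<open>h\<close>.\<close>
  have diff: "\<bar>(\<integral>\<omega>. ?f \<omega> u \<partial>M) - (\<integral>\<omega>. ?g \<omega> u \<partial>M)\<bar> \<le> c * (\<integral>\<omega>. ?h \<omega> u \<partial>M)" if u: "0 \<le> u" for u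
  proof -
    let ?V = "\<lambda>y. \<integral>\<omega>'. feynman_kac k h (\<lambda>s. y + (X (u + s) \<omega>' - X u \<omega>')) \<partial>M"
    have Vm: "?V \<in> borel_measurable borel"
      by (rule measurable_feynman_kac_translate_mean[OF continuous_BM_shift[OF X] k hm])
    have V_bounds: "\<bar>?V y\<bar> \<le> 1 + c" for y
      using close[OF u, of y] v_bounds[of y] by linarith
    have xu: "(\<lambda>\<omega>. x + X u \<omega>) \<in> borel_measurable M"
      by (intro borel_measurable_add borel_measurable_const continuous_BMD(2)[OF X])
    have ih: "integrable M (\<lambda>\<omega>. ?h \<omega> u)"
      by (rule integrable_const_bound[where B=b, OF AE_I2 measurable_compose[OF xu hm]])
         (simp only: real_norm_def h_bound)
    have iV: "integrable M (\<lambda>\<omega>. ?h \<omega> u * ?V (x + X u \<omega>))"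
    proof (rule integrable_const_bound[where B="b * (1 + c)"])
      show "AE \<omega> in M. norm (?h \<omega> u * ?V (x + X u \<omega>)) \<le> b * (1 + c)"
      proof (rule AE_I2)
        fix \<omega>
        have "norm (?h \<omega> u * ?V (x + X u \<omega>)) = \<bar>?h \<omega> u\<bar> * \<bar>?V (x + X u \<omega>)\<bar>"
          by (simp only: real_norm_def abs_mult)
        also have "\<dots> \<le> b * (1 + c)"
          by (rule mult_mono[OF h_bound V_bounds b abs_ge_zero])
        finally show "norm (?h \<omega> u * ?V (x + X u \<omega>)) \<le> b * (1 + c)" .
      qed
      show "(\<lambda>\<omega>. ?h \<omega> u * ?V (x + X u \<omega>)) \<in> borel_measurable M"
        by (intro borel_measurable_times measurable_compose[OF xu hm] measurable_compose[OF xu Vm])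
    qed
    have ig: "integrable M (\<lambda>\<omega>. ?g \<omega> u)"
    proof (rule integrable_const_bound[where B=b])
      show "AE \<omega> in M. norm (?g \<omega> u) \<le> b" by (rule AE_I2) (simp only: real_norm_def g_bound)
      show "(\<lambda>\<omega>. ?g \<omega> u) \<in> borel_measurable M"
        by (intro borel_measurable_times measurable_compose[OF xu hm] measurable_compose[OF xu vm])
    qed
    have split: "(\<integral>\<omega>. ?f \<omega> u \<partial>M) - (\<integral>\<omega>. ?g \<omega> u \<partial>M) =
        (\<integral>\<omega>. ?h \<omega> u * ?V (x + X u \<omega>) - ?g \<omega> u \<partial>M)"
      by (rule trans[OF arg_cong2[where f="(-)", OF continuous_BM_Markov[OF X u k h h_bounds] refl]
            Bochner_Integration.integral_diff[OF iV ig, symmetric]])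
    have "\<bar>\<integral>\<omega>. ?h \<omega> u * ?V (x + X u \<omega>) - ?g \<omega> u \<partial>M\<bar> \<le> (\<integral>\<omega>. \<bar>?h \<omega> u * ?V (x + X u \<omega>) - ?g \<omega> u\<bar> \<partial>M)"
      by (rule integral_abs_bound)
    also have "\<dots> \<le> (\<integral>\<omega>. c * ?h \<omega> u \<partial>M)"
    proof (rule integral_mono)
      show "integrable M (\<lambda>\<omega>. \<bar>?h \<omega> u * ?V (x + X u \<omega>) - ?g \<omega> u\<bar>)"
        by (intro integrable_abs Bochner_Integration.integrable_diff iV ig)
      show "integrable M (\<lambda>\<omega>. c * ?h \<omega> u)" by (intro integrable_mult_right ih)
      fix \<omega>
      have "\<bar>?h \<omega> u * ?V (x + X u \<omega>) - ?g \<omega> u\<bar> = ?h \<omega> u * \<bar>?V (x + X u \<omega>) - v (x + X u \<omega>)\<bar>"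
        by (simp only: right_diff_distrib[symmetric] abs_mult abs_of_nonneg[OF h_bounds(1)])
      also have "\<dots> \<le> ?h \<omega> u * c"
        by (intro mult_left_mono close[OF u] h_bounds)
      finally show "\<bar>?h \<omega> u * ?V (x + X u \<omega>) - ?g \<omega> u\<bar> \<le> c * ?h \<omega> u"
        by (simp only: mult.commute)
    qed
    also have "\<dots> = c * (\<integral>\<omega>. ?h \<omega> u \<partial>M)" by (rule integral_mult_right_zero)
    finally show ?thesis unfolding split .
  qed
  have "\<bar>(\<integral>u. (\<integral>\<omega>. ?f \<omega> u \<partial>M) \<partial>exponential_law k) - (\<integral>u. (\<integral>\<omega>. ?g \<omega> u \<partial>M) \<partial>exponential_law k)\<bar>
      = \<bar>\<integral>u. (\<integral>\<omega>. ?f \<omega> u \<partial>M) - (\<integral>\<omega>. ?g \<omega> u \<partial>M) \<partial>exponential_law k\<bar>"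
    by (subst Bochner_Integration.integral_diff[OF f(2) g(2)]) (rule refl)
  also have "\<dots> \<le> (\<integral>u. \<bar>(\<integral>\<omega>. ?f \<omega> u \<partial>M) - (\<integral>\<omega>. ?g \<omega> u \<partial>M)\<bar> \<partial>exponential_law k)"
    by (rule integral_abs_bound)
  also have "\<dots> \<le> (\<integral>u. c * (\<integral>\<omega>. ?h \<omega> u \<partial>M) \<partial>exponential_law k)"
  proof (rule integral_mono_AE)
    show "integrable (exponential_law k) (\<lambda>u. \<bar>(\<integral>\<omega>. ?f \<omega> u \<partial>M) - (\<integral>\<omega>. ?g \<omega> u \<partial>M)\<bar>)"
      by (intro integrable_abs Bochner_Integration.integrable_diff f(2) g(2))
    show "integrable (exponential_law k) (\<lambda>u. c * (\<integral>\<omega>. ?h \<omega> u \<partial>M))"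
      by (intro integrable_mult_right h'(2))
    show "AE u in exponential_law k. \<bar>(\<integral>\<omega>. ?f \<omega> u \<partial>M) - (\<integral>\<omega>. ?g \<omega> u \<partial>M)\<bar> \<le> c * (\<integral>\<omega>. ?h \<omega> u \<partial>M)"
      using AE_exponential_law_nonneg[of k] by eventually_elim (rule diff)
  qed
  also have "\<dots> = c * (\<integral>u. (\<integral>\<omega>. ?h \<omega> u \<partial>M) \<partial>exponential_law k)" by (rule integral_mult_right_zero)
  also have "\<dots> \<le> c * (k * \<theta>)" by (intro mult_left_mono small c)
  finally have le: "\<bar>(\<integral>u. (\<integral>\<omega>. ?f \<omega> u \<partial>M) \<partial>exponential_law k) - (\<integral>u. (\<integral>\<omega>. ?g \<omega> u \<partial>M) \<partial>exponential_law k)\<bar>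
      \<le> c * (k * \<theta>)" .
  have "\<bar>m - w\<bar> \<le> \<theta> * c" if "m = 1 - A / k" "w = 1 - B / k" "\<bar>A - B\<bar> \<le> c * (k * \<theta>)" for m w A B
  proof -
    have "m - w = - ((A - B) / k)" using that by (simp add: diff_divide_distrib)
    then have "\<bar>m - w\<bar> = \<bar>A - B\<bar> / k" using k by simp
    also have "\<dots> \<le> c * (k * \<theta>) / k" using that k by (intro divide_right_mono) auto
    finally show ?thesis using k by (simp add: mult.commute)
  qed
  from this[OF mean eq le] show ?thesis .
qed

text \<open>From v \<ge> 3/4 follows h \<le> (4/3) h v, and the weighted mean of h v equals e^2 (1 -
  v(x)) \<le> e^2 / 4 by the equation for \<open>kac_mean\<close>.\<close>

lemma kac_potential_mean_le:
  assumes e: "0 < e" "e \<le> 1" and X: "continuous_BM M X"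
  shows "(\<integral>u. (\<integral>\<omega>. kac_potential e (x + X u \<omega>) \<partial>M) \<partial>exponential_law (e\<^sup>2)) \<le> e\<^sup>2 * (1 / 3)"
proof -
  have k: "0 < e\<^sup>2" using e by simp
  have M: "prob_space M" by (rule continuous_BMD(1)[OF X])
  interpret prob_space M by (rule M)
  interpret Q: prob_space "exponential_law (e\<^sup>2)" by (rule prob_space_exponential_density[OF k])
  let ?h = "kac_potential e" and ?v = "kac_mean e"
  note hb = kac_potential_bounds[OF e] and vb = kac_mean_bounds[OF e]
  have hm: "?h \<in> borel_measurable borel" and vm: "?v \<in> borel_measurable borel"
    using continuous_kac_potential[OF e] continuous_kac_mean[OF e(1)]
    by (auto intro: borel_measurable_continuous_onI)
  have pair: "(\<lambda>p. x + X (fst p) (snd p)) \<in> borel_measurable (borel \<Otimes>\<^sub>M M)"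
    by (intro borel_measurable_add borel_measurable_const continuous_BM_measurable_pair[OF X])
  have xu: "(\<lambda>\<omega>. x + X u \<omega>) \<in> borel_measurable M" for u
    by (intro borel_measurable_add borel_measurable_const continuous_BMD(2)[OF X])
  have hv: "\<bar>?h y * ?v y\<bar> \<le> 1" for y
    using mult_mono[OF hb(2) vb(2), of y y] hb(1)[of y] vb(1)[of y] by (simp add: abs_mult)
  have hb': "\<bar>?h y\<bar> \<le> 1" for y using hb[of y] by simp
  have hv_pair: "(\<lambda>p. ?h (x + X (fst p) (snd p)) * ?v (x + X (fst p) (snd p))) \<in> borel_measurable (borel \<Otimes>\<^sub>M M)"
    by (intro borel_measurable_times measurable_compose[OF pair hm] measurable_compose[OF pair vm])
  have ihv: "integrable M (\<lambda>\<omega>. ?h (x + X u \<omega>) * ?v (x + X u \<omega>))" for u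
  proof (rule integrable_const_bound[where B=1])
    show "AE \<omega> in M. norm (?h (x + X u \<omega>) * ?v (x + X u \<omega>)) \<le> 1" using hv by simp
    show "(\<lambda>\<omega>. ?h (x + X u \<omega>) * ?v (x + X u \<omega>)) \<in> borel_measurable M"
      by (intro borel_measurable_times measurable_compose[OF xu hm] measurable_compose[OF xu vm])
  qed
  have ih: "integrable M (\<lambda>\<omega>. ?h (x + X u \<omega>))" for u
    by (rule integrable_const_bound[where B=1]) (use hb' measurable_compose[OF xu hm] in auto)
  have pointwise: "?h y \<le> 4 / 3 * (?h y * ?v y)" for y
    using mult_left_mono[OF vb(1)[of y] hb(1)[of y]] by simp
  note F_h = exponential_law_Fubini(2)[OF M k measurable_compose[OF pair hm] hb']
  note F_hv = exponential_law_Fubini(2)[OF M k hv_pair hv]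
  have "(\<integral>u. (\<integral>\<omega>. ?h (x + X u \<omega>) \<partial>M) \<partial>exponential_law (e\<^sup>2))
      \<le> (\<integral>u. 4 / 3 * (\<integral>\<omega>. ?h (x + X u \<omega>) * ?v (x + X u \<omega>) \<partial>M) \<partial>exponential_law (e\<^sup>2))"
  proof (rule integral_mono[OF F_h])
    show "integrable (exponential_law (e\<^sup>2)) (\<lambda>u. 4 / 3 * (\<integral>\<omega>. ?h (x + X u \<omega>) * ?v (x + X u \<omega>) \<partial>M))"
      by (intro integrable_mult_right F_hv)
    show "(\<integral>\<omega>. ?h (x + X u \<omega>) \<partial>M) \<le> 4 / 3 * (\<integral>\<omega>. ?h (x + X u \<omega>) * ?v (x + X u \<omega>) \<partial>M)" for u
      using integral_mono[OF ih integrable_mult_right[OF ihv, of "4 / 3"] pointwise]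
      by (simp only: integral_mult_right_zero)
  qed
  also have "\<dots> = 4 / 3 * (\<integral>u. (\<integral>\<omega>. ?h (x + X u \<omega>) * ?v (x + X u \<omega>) \<partial>M) \<partial>exponential_law (e\<^sup>2))"
    by (rule integral_mult_right_zero)
  also have "\<dots> = 4 / 3 * (e\<^sup>2 * (1 - ?v x))"
    by (subst kac_mean_eq[OF e X, of x]) (use e in simp)
  also have "\<dots> \<le> 4 / 3 * (e\<^sup>2 * (1 / 4))"
    using vb(1)[of x] e by (intro mult_left_mono) auto
  finally show ?thesis by simp
qed

text \<open>Both sides lie in [0, 1], and each contraction step divides the error by 3. The
  induction ranges over all Brownian motions on \<open>M\<close>, since a step passes from
  \<open>X\<close> to its shifts.\<close>

lemma feynman_kac_expectation:
  assumes e: "0 < e" "e \<le> 1" and X: "continuous_BM M X"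
  shows "(\<integral>\<omega>. feynman_kac (e\<^sup>2) (kac_potential e) (\<lambda>s. x + X s \<omega>) \<partial>M) = kac_mean e x"
proof -
  have k: "0 < e\<^sup>2" using e by simp
  note hb = kac_potential_bounds[OF e] and vb = kac_mean_bounds[OF e]
  have vb0: "0 \<le> kac_mean e y" for y using vb(1)[of y] by simp
  have approx: "\<bar>(\<integral>\<omega>. feynman_kac (e\<^sup>2) (kac_potential e) (\<lambda>s. x + X s \<omega>) \<partial>M) - kac_mean e x\<bar> \<le> (1 / 3) ^ n"
    if "continuous_BM M X" for X x n
    using that
  proof (induction n arbitrary: X x)
    case 0
    interpret prob_space M by (rule continuous_BMD(1)[OF 0])
    note V = feynman_kac_bounds[OF k hb(1)]
    have m: "(\<lambda>\<omega>. feynman_kac (e\<^sup>2) (kac_potential e) (\<lambda>s. x + X s \<omega>)) \<in> borel_measurable M"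
      using measurable_feynman_kac[OF k borel_measurable_continuous_onI[OF continuous_kac_potential[OF e]]
          continuous_BM_path_translate[OF 0, of x 0]] by (simp only: add_0)
    have "integrable M (\<lambda>\<omega>. feynman_kac (e\<^sup>2) (kac_potential e) (\<lambda>s. x + X s \<omega>))"
      by (rule integrable_const_bound[where B=1, OF _ m]) (use V in simp)
    then have "0 \<le> (\<integral>\<omega>. feynman_kac (e\<^sup>2) (kac_potential e) (\<lambda>s. x + X s \<omega>) \<partial>M)"
      "(\<integral>\<omega>. feynman_kac (e\<^sup>2) (kac_potential e) (\<lambda>s. x + X s \<omega>) \<partial>M) \<le> 1"
      using V by (auto intro!: integral_le_const Bochner_Integration.integral_nonneg)
    then show ?case using vb0[of x] vb(2)[of x] by (simp add: abs_le_iff)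
  next
    case (Suc n)
    have "\<bar>(\<integral>\<omega>. feynman_kac (e\<^sup>2) (kac_potential e) (\<lambda>s. x + X s \<omega>) \<partial>M) - kac_mean e x\<bar> \<le> 1 / 3 * (1 / 3) ^ n"
      by (rule feynman_kac_expectation_step[OF Suc.prems k continuous_kac_potential[OF e] hb(1,2)
            continuous_kac_mean[OF e(1)] vb0 vb(2) kac_mean_eq[OF e Suc.prems]
            kac_potential_mean_le[OF e Suc.prems]])
         (simp, rule Suc.IH[OF continuous_BM_shift[OF Suc.prems]])
    then show ?case by (simp only: power_Suc)
  qed
  have "(\<lambda>n. (1 / 3 :: real) ^ n) \<longlonglongrightarrow> 0" by (rule LIMSEQ_power_zero) simp
  from LIMSEQ_le_const[OF this, of "\<bar>(\<integral>\<omega>. feynman_kac (e\<^sup>2) (kac_potential e) (\<lambda>s. x + X s \<omega>) \<partial>M) - kac_mean e x\<bar>"]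
  show ?thesis using approx[OF X] by simp
qed

subsection \<open>Unbiased shifts\<close>

lemma measurable_two_sided_kac:
  assumes k: "0 < k" and h: "h \<in> borel_measurable borel" and f: "f \<in> N \<rightarrow>\<^sub>M path_space"
  shows "(\<lambda>x. two_sided_kac k h (f x)) \<in> borel_measurable N"
proof -
  have "(\<lambda>x s. f x (- s)) \<in> N \<rightarrow>\<^sub>M path_space"
  proof (rule measurable_path_spaceI)
    show "(\<lambda>x. f x (- s)) \<in> borel_measurable N" for s
      by (rule measurable_compose[OF f measurable_path_coord])
    show "continuous_on UNIV (\<lambda>s. f x (- s))" if "x \<in> space N" for x
      by (rule continuous_on_compose2[OF continuous_path[OF f that]])
         (intro continuous_on_minus continuous_on_id, simp)
  qed
  from measurable_feynman_kac[OF k h this] measurable_feynman_kac[OF k h f]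
  show ?thesis unfolding two_sided_kac_def by (intro borel_measurable_times)
qed

text \<open>The forward factor depends on the future and the backward factor on the past, so the
  mean factorizes. The reversed process is again a Brownian motion, so both factors have the same
  mean.\<close>

lemma two_sided_kac_expectation:
  assumes e: "0 < e" "e \<le> 1" and X: "continuous_BM M X"
  shows "(\<integral>\<omega>. two_sided_kac (e\<^sup>2) (kac_potential e) (\<lambda>s. x + X s \<omega>) \<partial>M) = (kac_mean e x)\<^sup>2"
proof -
  interpret prob_space M by (rule continuous_BMD(1)[OF X])
  have k: "0 < e\<^sup>2" using e by simp
  note V = feynman_kac_bounds[OF k kac_potential_bounds(1)[OF e]]
  have hm: "kac_potential e \<in> borel_measurable borel"
    by (rule borel_measurable_continuous_onI[OF continuous_kac_potential[OF e]])
  let ?V = "feynman_kac (e\<^sup>2) (kac_potential e)"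
  let ?F = "\<lambda>\<omega> s. X (max s 0) \<omega> - X 0 \<omega>" and ?P = "\<lambda>\<omega> s. X (- max s 0) \<omega> - X 0 \<omega>"
  let ?G = "\<lambda>p. ?V (\<lambda>s. x + fst p s) * ?V (\<lambda>s. x + snd p s)"
  have F: "?F \<in> M \<rightarrow>\<^sub>M path_space"
    by (rule continuous_BM_path[OF X]) (intro continuous_intros)
  have P: "?P \<in> M \<rightarrow>\<^sub>M path_space"
    by (rule continuous_BM_path[OF X]) (intro continuous_intros)
  have add: "(\<lambda>z s. x + f z s) \<in> N \<rightarrow>\<^sub>M path_space" if f: "f \<in> N \<rightarrow>\<^sub>M path_space"
    for N :: "'z measure" and f
  proof (rule measurable_path_spaceI)
    show "(\<lambda>z. x + f z s) \<in> borel_measurable N" for s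
      by (intro borel_measurable_add borel_measurable_const measurable_compose[OF f measurable_path_coord])
    show "continuous_on UNIV (\<lambda>s. x + f z s)" if "z \<in> space N" for z
      by (intro continuous_on_add continuous_on_const continuous_path[OF f that])
  qed
  have G: "?G \<in> borel_measurable (path_space \<Otimes>\<^sub>M path_space)"
    by (intro borel_measurable_times measurable_feynman_kac[OF k hm] add measurable_fst measurable_snd)
  have G_bound: "\<bar>?G p\<bar> \<le> 1" for p
    using V by (simp add: abs_mult mult_le_one)
  have F_eq: "?V (\<lambda>s. x + ?F \<omega> s) = ?V (\<lambda>s. x + X s \<omega>)" if "X 0 \<omega> = 0" for \<omega>
    using that by (intro feynman_kac_cong) simp
  have P_eq: "?V (\<lambda>s. x + ?P \<omega> s) = ?V (\<lambda>s. x + X (- s) \<omega>)" if "X 0 \<omega> = 0" for \<omega>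
    using that by (intro feynman_kac_cong) simp
  note mF = measurable_feynman_kac[OF k hm add[OF F]]
    and mP = measurable_feynman_kac[OF k hm add[OF P]]
  have path: "(\<lambda>\<omega> s. x + X (0 + s) \<omega>) \<in> M \<rightarrow>\<^sub>M path_space"
    by (rule continuous_BM_path_translate[OF X])
  have path': "(\<lambda>\<omega> s. x + X (- (0 + s)) \<omega>) \<in> M \<rightarrow>\<^sub>M path_space"
    by (rule continuous_BM_path_translate[OF continuous_BM_reverse[OF X]])
  have mX: "(\<lambda>\<omega>. ?V (\<lambda>s. x + X s \<omega>)) \<in> borel_measurable M"
    using measurable_feynman_kac[OF k hm path] by (simp only: add_0)
  have mX': "(\<lambda>\<omega>. ?V (\<lambda>s. x + X (- s) \<omega>)) \<in> borel_measurable M"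
    using measurable_feynman_kac[OF k hm path'] by (simp only: add_0)
  have "(\<integral>\<omega>. two_sided_kac (e\<^sup>2) (kac_potential e) (\<lambda>s. x + X s \<omega>) \<partial>M)
      = (\<integral>\<omega>. ?V (\<lambda>s. x + X s \<omega>) * ?V (\<lambda>s. x + X (- s) \<omega>) \<partial>M)"
    by (simp only: two_sided_kac_def)
  also have "\<dots> = (\<integral>\<omega>. ?V (\<lambda>s. x + ?F \<omega> s) * ?V (\<lambda>s. x + ?P \<omega> s) \<partial>M)"
  proof (rule integral_cong_AE)
    show "AE \<omega> in M. ?V (\<lambda>s. x + X s \<omega>) * ?V (\<lambda>s. x + X (- s) \<omega>) =
        ?V (\<lambda>s. x + ?F \<omega> s) * ?V (\<lambda>s. x + ?P \<omega> s)"
      using continuous_BMD(3)[OF X]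
    proof eventually_elim
      case (elim \<omega>)
      show ?case unfolding F_eq[OF elim] P_eq[OF elim] ..
    qed
  qed (intro borel_measurable_times mF mP mX mX')+
  also have "\<dots> = (\<integral>\<omega>. ?G (?F \<omega>, ?P \<omega>) \<partial>M)" by (simp only: fst_conv snd_conv)
  also have "\<dots> = (\<integral>\<omega>. (\<integral>\<omega>'. ?G (?F \<omega>', ?P \<omega>) \<partial>M) \<partial>M)"
    by (rule indep_set_expectation[OF F P continuous_BM_indep_past_future[OF X] G G_bound])
  also have "\<dots> = (\<integral>\<omega>. ?V (\<lambda>s. x + ?F \<omega> s) \<partial>M) * (\<integral>\<omega>. ?V (\<lambda>s. x + ?P \<omega> s) \<partial>M)"
    by (simp only: fst_conv snd_conv integral_mult_left_zero integral_mult_right_zero)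
  also have "(\<integral>\<omega>. ?V (\<lambda>s. x + ?F \<omega> s) \<partial>M) = (\<integral>\<omega>. ?V (\<lambda>s. x + X s \<omega>) \<partial>M)"
  proof (rule integral_cong_AE[OF mF mX])
    show "AE \<omega> in M. ?V (\<lambda>s. x + ?F \<omega> s) = ?V (\<lambda>s. x + X s \<omega>)"
      using continuous_BMD(3)[OF X] by eventually_elim (rule F_eq)
  qed
  also have "(\<integral>\<omega>. ?V (\<lambda>s. x + ?P \<omega> s) \<partial>M) = (\<integral>\<omega>. ?V (\<lambda>s. x + X (- s) \<omega>) \<partial>M)"
  proof (rule integral_cong_AE[OF mP mX'])
    show "AE \<omega> in M. ?V (\<lambda>s. x + ?P \<omega> s) = ?V (\<lambda>s. x + X (- s) \<omega>)"
      using continuous_BMD(3)[OF X] by eventually_elim (rule P_eq)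
  qed
  also have "(\<integral>\<omega>. ?V (\<lambda>s. x + X s \<omega>) \<partial>M) * (\<integral>\<omega>. ?V (\<lambda>s. x + X (- s) \<omega>) \<partial>M) = (kac_mean e x)\<^sup>2"
    unfolding feynman_kac_expectation[OF e X] feynman_kac_expectation[OF e continuous_BM_reverse[OF X]]
    by (simp only: power2_eq_square)
  finally show ?thesis .
qed

text \<open>The left side is the mean change of the two-sided functional when the origin of time
  moves from 0 to \<open>T\<close>: seen from \<open>T\<close> the path is a Brownian motion
  \<open>W\<close> started at the independent point \<open>Y\<close>. The right side bounds this
  change path by path, with no stopping property of \<open>T\<close>.\<close>

lemma unbiased_shift_kac_mean_le:
  assumes P: "is_BM_law P" and T: "unbiased_shift P T" and e: "0 < e" "e \<le> 1"
  shows "(\<integral>\<omega>. (kac_mean e (\<omega> (T \<omega>)))\<^sup>2 - (kac_mean e 0)\<^sup>2 \<partial>P) \<le> (\<integral>\<omega>. min 1 (e\<^sup>2 * \<bar>T \<omega>\<bar>) \<partial>P)"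
proof -
  have sets_P: "sets P = sets path_space" and BM: "two_sided_BM P (\<lambda>t \<omega>. \<omega> t)"
    using P by (auto simp: is_BM_law_def)
  interpret prob_space P using BM by (simp add: two_sided_BM_def)
  have space_P: "space P = {w. continuous_on UNIV w}"
    using sets_eq_imp_space_eq[OF sets_P] by (simp only: space_path_space)
  have X: "continuous_BM P (\<lambda>t \<omega>. \<omega> t)"
    using BM by (simp add: continuous_BM_def space_P)
  have Tm: "T \<in> borel_measurable P"
    using T by (simp add: unbiased_shift_def random_time_def measurable_cong_sets[OF sets_P refl])
  have id_path: "(\<lambda>\<omega>. \<omega>) \<in> P \<rightarrow>\<^sub>M path_space"
    by (rule measurable_ident_sets[OF sets_P])
  let ?Y = "\<lambda>\<omega>. \<omega> (T \<omega>)" and ?W = "\<lambda>t \<omega>. \<omega> (T \<omega> + t) - \<omega> (T \<omega>)"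
  have Y: "?Y \<in> borel_measurable P"
    by (rule measurable_path_eval'[OF id_path Tm])
  have "two_sided_BM P ?W" and
    ind: "indep_set (sets (vimage_algebra (space P) (\<lambda>\<omega> t. ?W t \<omega>) path_space))
      (sets (vimage_algebra (space P) ?Y borel))"
    using T by (auto simp: unbiased_shift_def)
  moreover have cont_shift: "continuous_on UNIV (\<lambda>t. \<omega> (r + t))" if "\<omega> \<in> space P" for \<omega> and r :: real
    using that unfolding space_P
    by (intro continuous_on_compose2[of UNIV \<omega> UNIV "\<lambda>t. r + t"] continuous_on_add
        continuous_on_const continuous_on_id) auto
  ultimately have W: "continuous_BM P ?W"
    unfolding continuous_BM_def by (intro conjI ballI continuous_on_diff continuous_on_const)
  have W_path: "(\<lambda>\<omega> t. ?W t \<omega>) \<in> P \<rightarrow>\<^sub>M path_space"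
    using continuous_BMD(2,4)[OF W] by (intro measurable_path_spaceI)
  have k: "0 < e\<^sup>2" using e by simp
  have h: "continuous_on UNIV (kac_potential e)" by (rule continuous_kac_potential[OF e])
  have hm: "kac_potential e \<in> borel_measurable borel" by (rule borel_measurable_continuous_onI[OF h])
  note h0 = kac_potential_bounds(1)[OF e]
  let ?\<Phi> = "two_sided_kac (e\<^sup>2) (kac_potential e)"
  note \<Phi> = two_sided_kac_bounds[where h="kac_potential e", OF k h0]
  have add: "(\<lambda>p s. snd p + fst p s) \<in> path_space \<Otimes>\<^sub>M borel \<rightarrow>\<^sub>M path_space"
  proof (rule measurable_path_spaceI)
    show "(\<lambda>p. snd p + fst p s) \<in> borel_measurable (path_space \<Otimes>\<^sub>M borel)" for s
      by (intro borel_measurable_add measurable_snd measurable_compose[OF measurable_fst measurable_path_coord])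
    show "continuous_on UNIV (\<lambda>s. snd p + fst p s)" if "p \<in> space (path_space \<Otimes>\<^sub>M borel)" for p :: "(real \<Rightarrow> real) \<times> real"
      by (intro continuous_on_add continuous_on_const continuous_path[OF measurable_fst that])
  qed
  let ?G = "\<lambda>p. ?\<Phi> (\<lambda>s. snd p + fst p s)"
  have G: "?G \<in> borel_measurable (path_space \<Otimes>\<^sub>M borel)"
    by (rule measurable_two_sided_kac[OF k hm add])
  have G_bound: "\<bar>?G p\<bar> \<le> 1" for p using \<Phi> by simp
  \<comment> \<open>The path seen from \<open>T\<close> is \<open>Y + W\<close>, a function of the
    two independent parts.\<close>
  have eq: "?\<Phi> (\<lambda>s. \<omega> (T \<omega> + s)) = ?G (\<lambda>t. ?W t \<omega>, ?Y \<omega>)" for \<omega>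
    by simp
  have m_shift: "(\<lambda>\<omega>. ?\<Phi> (\<lambda>s. \<omega> (T \<omega> + s))) \<in> borel_measurable P"
    unfolding eq by (rule measurable_compose[OF measurable_Pair[OF W_path Y] G])
  have m_id: "(\<lambda>\<omega>. ?\<Phi> \<omega>) \<in> borel_measurable P"
    by (rule measurable_two_sided_kac[OF k hm id_path])
  have i_shift: "integrable P (\<lambda>\<omega>. ?\<Phi> (\<lambda>s. \<omega> (T \<omega> + s)))"
    by (rule integrable_const_bound[where B=1, OF AE_I2 m_shift]) (simp add: \<Phi>)
  have i_id: "integrable P (\<lambda>\<omega>. ?\<Phi> \<omega>)"
    by (rule integrable_const_bound[where B=1, OF AE_I2 m_id]) (simp add: \<Phi>)
  have shift: "(\<integral>\<omega>. ?\<Phi> (\<lambda>s. \<omega> (T \<omega> + s)) \<partial>P) = (\<integral>\<omega>. (kac_mean e (?Y \<omega>))\<^sup>2 \<partial>P)"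
  proof -
    have "(\<integral>\<omega>. ?\<Phi> (\<lambda>s. \<omega> (T \<omega> + s)) \<partial>P) = (\<integral>\<omega>. ?G (\<lambda>t. ?W t \<omega>, ?Y \<omega>) \<partial>P)"
      unfolding eq ..
    also have "\<dots> = (\<integral>\<omega>. (\<integral>\<omega>'. ?G (\<lambda>t. ?W t \<omega>', ?Y \<omega>) \<partial>P) \<partial>P)"
      by (rule indep_set_expectation[OF W_path Y ind G G_bound])
    also have "\<dots> = (\<integral>\<omega>. (kac_mean e (?Y \<omega>))\<^sup>2 \<partial>P)"
      using two_sided_kac_expectation[OF e W] by (simp only: fst_conv snd_conv)
    finally show ?thesis .
  qed
  have id: "(\<integral>\<omega>. ?\<Phi> \<omega> \<partial>P) = (kac_mean e 0)\<^sup>2"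
    using two_sided_kac_expectation[OF e X, of 0] by (simp only: add_0)
  have vm: "kac_mean e \<in> borel_measurable borel"
    by (rule borel_measurable_continuous_onI[OF continuous_kac_mean[OF e(1)]])
  have vb: "(kac_mean e y)\<^sup>2 \<le> 1" for y
    using kac_mean_bounds[OF e, of y] by (intro power_le_one) auto
  have "integrable P (\<lambda>\<omega>. (kac_mean e (?Y \<omega>))\<^sup>2)"
    by (rule integrable_const_bound[where B=1, OF AE_I2 borel_measurable_power[OF measurable_compose[OF Y vm]]])
       (simp add: vb)
  then have "(\<integral>\<omega>. (kac_mean e (?Y \<omega>))\<^sup>2 - (kac_mean e 0)\<^sup>2 \<partial>P) =
      (\<integral>\<omega>. (kac_mean e (?Y \<omega>))\<^sup>2 \<partial>P) - (kac_mean e 0)\<^sup>2"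
    by (subst Bochner_Integration.integral_diff) (simp_all add: prob_space)
  also have "\<dots> = (\<integral>\<omega>. ?\<Phi> (\<lambda>s. \<omega> (T \<omega> + s)) - ?\<Phi> \<omega> \<partial>P)"
    unfolding shift[symmetric] id[symmetric]
    by (rule Bochner_Integration.integral_diff[OF i_shift i_id, symmetric])
  also have "\<dots> \<le> (\<integral>\<omega>. min 1 (e\<^sup>2 * \<bar>T \<omega>\<bar>) \<partial>P)"
  proof (rule integral_mono)
    show "integrable P (\<lambda>\<omega>. ?\<Phi> (\<lambda>s. \<omega> (T \<omega> + s)) - ?\<Phi> \<omega>)"
      by (rule Bochner_Integration.integrable_diff[OF i_shift i_id])
    have "(\<lambda>\<omega>. min 1 (e\<^sup>2 * \<bar>T \<omega>\<bar>)) \<in> borel_measurable P"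
      by (intro borel_measurable_min borel_measurable_const borel_measurable_times borel_measurable_abs Tm)
    then show "integrable P (\<lambda>\<omega>. min 1 (e\<^sup>2 * \<bar>T \<omega>\<bar>))"
      by (rule integrable_const_bound[where B=1, OF AE_I2, rotated]) auto
    fix \<omega> assume "\<omega> \<in> space P"
    then have "continuous_on UNIV \<omega>" by (simp only: space_P mem_Collect_eq)
    \<comment> \<open>The Lipschitz bound holds for each deterministic shift, so it may be applied
      with the value of \<open>T\<close> on the given path; the bound 1 comes from both functionals
      lying in [0, 1].\<close>
    from two_sided_kac_lipschitz[OF k this h h0, of "T \<omega>"] \<Phi>[where w="\<lambda>s. \<omega> (T \<omega> + s)"] \<Phi>[where w=\<omega>]
    show "?\<Phi> (\<lambda>s. \<omega> (T \<omega> + s)) - ?\<Phi> \<omega> \<le> min 1 (e\<^sup>2 * \<bar>T \<omega>\<bar>)"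
      by linarith
  qed
  finally show ?thesis .
qed

text \<open>The smaller of two nonnegative numbers is at most their geometric mean, and here
  \<open>e\<close> cancels in the product.\<close>

lemma min_inverse_le_sqrt:
  assumes "0 < e" "0 \<le> t"
  shows "min (1 / e) (e * t) \<le> sqrt t"
proof (rule real_le_rsqrt)
  have "(min (1 / e) (e * t))\<^sup>2 \<le> (1 / e) * (e * t)"
    unfolding power2_eq_square using assms by (intro mult_mono) auto
  then show "(min (1 / e) (e * t))\<^sup>2 \<le> t" using assms by simp
qed

theorem theorem8p4:
  fixes P\<^sub>0 :: "(real \<Rightarrow> real) measure"
    and T :: "(real \<Rightarrow> real) \<Rightarrow> real"
    and \<nu> :: "real measure"
  assumes "is_BM_law P\<^sub>0"
    and "prob_space \<nu>" and "sets \<nu> = sets borel"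
    and "\<nu> \<noteq> return borel 0"
    and "unbiased_shift P\<^sub>0 T"
    and "embeds P\<^sub>0 T \<nu>"
  shows "(\<integral>\<^sup>+ \<omega>. ennreal (sqrt \<bar>T \<omega>\<bar>) \<partial>P\<^sub>0) = \<infinity>"
proof (rule ccontr)
  assume finite: "(\<integral>\<^sup>+ \<omega>. ennreal (sqrt \<bar>T \<omega>\<bar>) \<partial>P\<^sub>0) \<noteq> \<infinity>"
  have sets_P: "sets P\<^sub>0 = sets path_space" and "prob_space P\<^sub>0"
    using assms(1) by (auto simp: is_BM_law_def two_sided_BM_def)
  then interpret prob_space P\<^sub>0 by simp
  have T: "T \<in> borel_measurable P\<^sub>0"
    using assms(5) by (simp add: unbiased_shift_def random_time_def measurable_cong_sets[OF sets_P refl])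
  have Y: "(\<lambda>\<omega>. \<omega> (T \<omega>)) \<in> borel_measurable P\<^sub>0"
    by (rule measurable_path_eval'[OF measurable_ident_sets[OF sets_P] T])
  have sqrt_m: "(\<lambda>\<omega>. sqrt \<bar>T \<omega>\<bar>) \<in> borel_measurable P\<^sub>0"
    using T by simp
  have sqrt_int: "integrable P\<^sub>0 (\<lambda>\<omega>. sqrt \<bar>T \<omega>\<bar>)"
    using finite by (intro integrableI_nonneg sqrt_m) (auto simp: less_top)
  \<comment> \<open>The gap function of \<open>kac_mean_square_diff_ge\<close> with the factor
    \<open>e\<close> removed; the same \<open>d\<close> works for every scale.\<close>
  define d :: "real \<Rightarrow> real" where "d = (\<lambda>y. (1 - exp (- y\<^sup>2 / 4)) / 128)"
  have d_nonneg: "0 \<le> d y" for y by (simp add: d_def)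
  have d_le: "d y \<le> 1" for y
  proof -
    have "(1 - z) / 128 \<le> 1" if "0 < z" for z :: real using that by simp
    from this[OF exp_gt_zero] show ?thesis unfolding d_def .
  qed
  have d_m: "(\<lambda>\<omega>. d (\<omega> (T \<omega>))) \<in> borel_measurable P\<^sub>0"
    unfolding d_def by (rule measurable_compose[OF Y]) simp
  have d_int: "integrable P\<^sub>0 (\<lambda>\<omega>. d (\<omega> (T \<omega>)))"
    by (rule integrable_const_bound[where B=1, OF AE_I2 d_m]) (simp add: d_nonneg d_le)
  have bound: "(\<integral>\<omega>. d (\<omega> (T \<omega>)) \<partial>P\<^sub>0) \<le> (\<integral>\<omega>. min (1 / e) (e * \<bar>T \<omega>\<bar>) \<partial>P\<^sub>0)"
    if e: "0 < e" "e \<le> 1" for e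
  proof -
    let ?D = "\<lambda>\<omega>. (kac_mean e (\<omega> (T \<omega>)))\<^sup>2 - (kac_mean e 0)\<^sup>2"
    have vb: "0 \<le> (kac_mean e y)\<^sup>2 \<and> (kac_mean e y)\<^sup>2 \<le> 1" for y
      using kac_mean_bounds[OF e, of y] by (auto intro!: power_le_one)
    have "?D \<in> borel_measurable P\<^sub>0"
      by (intro borel_measurable_diff borel_measurable_power borel_measurable_const measurable_compose[OF Y]
          borel_measurable_continuous_onI continuous_kac_mean e)
    then have D_int: "integrable P\<^sub>0 ?D"
    proof (rule integrable_const_bound[where B=1, OF AE_I2, rotated])
      show "norm (?D \<omega>) \<le> 1" for \<omega>
        using vb[of "\<omega> (T \<omega>)"] vb[of 0] unfolding real_norm_def by linarith
    qed
    have "e * (\<integral>\<omega>. d (\<omega> (T \<omega>)) \<partial>P\<^sub>0) = (\<integral>\<omega>. e * d (\<omega> (T \<omega>)) \<partial>P\<^sub>0)" by simp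
    also have "\<dots> \<le> (\<integral>\<omega>. ?D \<omega> \<partial>P\<^sub>0)"
      by (rule integral_mono[OF integrable_mult_right[OF d_int] D_int])
         (unfold d_def, rule kac_mean_square_diff_ge[OF e])
    also have "\<dots> \<le> (\<integral>\<omega>. min 1 (e\<^sup>2 * \<bar>T \<omega>\<bar>) \<partial>P\<^sub>0)"
      by (rule unbiased_shift_kac_mean_le[OF assms(1,5) e])
    \<comment> \<open>One factor \<open>e\<close> is taken out of the minimum, to be cancelled
      against the one in front of the mean of \<open>d\<close>.\<close>
    also have "\<dots> = (\<integral>\<omega>. e * min (1 / e) (e * \<bar>T \<omega>\<bar>) \<partial>P\<^sub>0)"
      using e by (simp add: min_mult_distrib_left power2_eq_square mult.assoc)
    also have "\<dots> = e * (\<integral>\<omega>. min (1 / e) (e * \<bar>T \<omega>\<bar>) \<partial>P\<^sub>0)" by simp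
    finally show ?thesis using e by simp
  qed
  define \<epsilon> where "\<epsilon> = (\<lambda>n. inverse (real (Suc n)))"
  have \<epsilon>: "0 < \<epsilon> n" "\<epsilon> n \<le> 1" for n by (auto simp: \<epsilon>_def inverse_le_1_iff)
  have \<epsilon>_lim: "\<epsilon> \<longlonglongrightarrow> 0" unfolding \<epsilon>_def by (rule LIMSEQ_inverse_real_of_nat)
  \<comment> \<open>The assumed integrability enters here, as
    \<open>sqrt \<bar>T \<omega>\<bar>\<close> dominates at every scale; the second argument of the
    minimum forces the pointwise limit 0.\<close>
  have "(\<lambda>n. \<integral>\<omega>. min (1 / \<epsilon> n) (\<epsilon> n * \<bar>T \<omega>\<bar>) \<partial>P\<^sub>0) \<longlonglongrightarrow> (\<integral>\<omega>. 0 \<partial>P\<^sub>0)"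
  proof (rule integral_dominated_convergence[OF _ _ sqrt_int])
    show "(\<lambda>\<omega>. min (1 / \<epsilon> n) (\<epsilon> n * \<bar>T \<omega>\<bar>)) \<in> borel_measurable P\<^sub>0" for n
      by (intro borel_measurable_min borel_measurable_const borel_measurable_times borel_measurable_abs T)
    show "AE \<omega> in P\<^sub>0. (\<lambda>n. min (1 / \<epsilon> n) (\<epsilon> n * \<bar>T \<omega>\<bar>)) \<longlonglongrightarrow> 0"
    proof (rule AE_I2)
      fix \<omega>
      have "(\<lambda>n. \<epsilon> n * \<bar>T \<omega>\<bar>) \<longlonglongrightarrow> 0"
        using tendsto_mult_right[OF \<epsilon>_lim, of "\<bar>T \<omega>\<bar>"] by simp
      then show "(\<lambda>n. min (1 / \<epsilon> n) (\<epsilon> n * \<bar>T \<omega>\<bar>)) \<longlonglongrightarrow> 0"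
        by (rule tendsto_sandwich[OF _ _ tendsto_const, rotated 2])
           (use \<epsilon>(1) in \<open>auto intro!: always_eventually simp: less_imp_le\<close>)
    qed
    show "AE \<omega> in P\<^sub>0. norm (min (1 / \<epsilon> n) (\<epsilon> n * \<bar>T \<omega>\<bar>)) \<le> sqrt \<bar>T \<omega>\<bar>" for n
    proof (rule AE_I2)
      fix \<omega>
      have "0 \<le> min (1 / \<epsilon> n) (\<epsilon> n * \<bar>T \<omega>\<bar>)" using \<epsilon>(1)[of n] by simp
      then show "norm (min (1 / \<epsilon> n) (\<epsilon> n * \<bar>T \<omega>\<bar>)) \<le> sqrt \<bar>T \<omega>\<bar>"
        using min_inverse_le_sqrt[OF \<epsilon>(1)[of n], of "\<bar>T \<omega>\<bar>"] by simp
    qed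
  qed simp
  then have "(\<lambda>n. \<integral>\<omega>. min (1 / \<epsilon> n) (\<epsilon> n * \<bar>T \<omega>\<bar>) \<partial>P\<^sub>0) \<longlonglongrightarrow> 0"
    by (simp only: Bochner_Integration.integral_zero)
  then have "(\<integral>\<omega>. d (\<omega> (T \<omega>)) \<partial>P\<^sub>0) \<le> 0"
    by (rule LIMSEQ_le_const) (intro exI[of _ 0] allI impI bound[OF \<epsilon>])
  moreover have "0 \<le> (\<integral>\<omega>. d (\<omega> (T \<omega>)) \<partial>P\<^sub>0)" by (simp add: d_nonneg)
  ultimately have "(\<integral>\<omega>. d (\<omega> (T \<omega>)) \<partial>P\<^sub>0) = 0" by simp
  then have "AE \<omega> in P\<^sub>0. d (\<omega> (T \<omega>)) = 0"
    using integral_nonneg_eq_0_iff_AE[OF d_int] d_nonneg by simp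
  \<comment> \<open>The function \<open>d\<close> vanishes only at 0.\<close>
  then have "AE \<omega> in P\<^sub>0. \<omega> (T \<omega>) = 0"
    by eventually_elim (simp add: d_def)
  then have "distr P\<^sub>0 borel (\<lambda>\<omega>. \<omega> (T \<omega>)) = distr P\<^sub>0 borel (\<lambda>_. 0)"
    by (intro distr_cong_AE) (use Y in auto)
  also have "\<dots> = return borel 0" by simp
  finally show False using assms(4,6) by (simp add: embeds_def)
qed

end
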